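(* Let $X$ be a fractional Ornstein-Uhlenbeck (fOU) process on $[0,T]$ driven by a fractional Brownian motion with Hurst parameter $H\in(\frac13,\frac12]$, that is, $dX_t=-\Gamma X_t\,dt+\Sigma\,dB^H_t$, $X_0=x_0\in\mathbb{R}^d$, with drift matrix $\Gamma\in\mathbb{R}^{d\times d}$ symmetric and positive-definite and volatility matrix $\Sigma\in\mathbb{R}^{d\times d}$ non-degenerate, and let $(X,\mathbb{X})$ be its It\^o rough path enhancement. Then the rough path estimator (of $\Gamma$) $$\widehat{\Gamma}_T:\ (X(\omega),\mathbb{X}(\omega))\ \mapsto\ \widehat{\Gamma}_T\big((X(\omega),\mathbb{X}(\omega))\big),\qquad \widehat{\Gamma}_T=-\mathcal{L}_T^{-1}S_T,$$ $$\mathcal{L}_T=\int_0^T(I\otimes X_s)^{T}Q^{-1}(I\otimes X_s)\,ds,\qquad S_T=\int_0^T(I\otimes X_s)^{T}Q^{-1}\,d_{\mathfrak{R}_1}\mathbf{X},\qquad Q=\Sigma\Sigma^{T},$$ regarded as a functional on the rough path space $\Omega_p([0,T],\mathbb{R}^d)$, is continuous with respect to the $p$-variation distance $d_p$ for $\frac1H<p<3$.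
   Context: $B^H$ is a $d$-dimensional fractional Brownian motion with Hurst parameter $H$: a continuous centred Gaussian process with independent components, each of covariance $\frac12(u^{2H}+s^{2H}-|u-s|^{2H})$. Since $H\le\frac12$, the condition $p>\frac1H$ gives $p>2$. Elements $x\otimes y$ are identified with matrices $(x^iy^j)_{i,j}$. Rough paths. For $2<p<3$, a $p$-rough path over $\mathbb{R}^e$ on $[0,T]$ is a map $(s,t)\mapsto(1,Y_{s,t},\mathbb{Y}_{s,t})$, $0\le s<t\le T$, with $Y_{s,t}=Y_t-Y_s\in\mathbb{R}^e$ for a continuous path $Y$ and $\mathbb{Y}_{s,t}\in\mathbb{R}^e\otimes\mathbb{R}^e$, satisfying Chen's identity $\mathbb{Y}_{s,t}-\mathbb{Y}_{s,u}-\mathbb{Y}_{u,t}=Y_{s,u}\otimes Y_{u,t}$ and having finite $p$-variation: there is a control $\omega$ (non-negative, continuous, super-additive, zero on the diagonal) with $|Y_{s,t}|\le\omega(s,t)^{1/p}$ and $|\mathbb{Y}_{s,t}|\le\omega(s,t)^{2/p}$. The space of $p$-rough paths over $\mathbb{R}^d$ on $[0,T]$ is $\Omega_p([0,T],\mathbb{R}^d)$. Writing $\mathbf{X}=(\mathbf{X}^1,\mathbf{X}^2)$ for the two levels, the $p$-variation distance is $$d_p(\mathbf{X},\mathbf{Y})=\max_{i=1,2}\ \sup_{\mathcal P}\Big(\sum_\ell|\mathbf{X}^i_{t_{\ell-1},t_\ell}-\mathbf{Y}^i_{t_{\ell-1},t_\ell}|^{p/i}\Big)^{i/p},$$ the supremum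 being over partitions $\mathcal P=\{t_\ell\}$ of $[0,T]$. Rough integrals. $\int F(Y)\,d_{\mathfrak R}\mathbf{Y}$ is the rough path with first level $I^1_{u,v}=\int_u^vF(Y)\,d_{\mathfrak{R}_1}\mathbf{Y}=\lim_{|\mathcal P|\to0}\sum_{[s,t]\in\mathcal P}\big(F(Y_s)Y_{s,t}+DF(Y_s)\mathbb{Y}_{s,t}\big)$ and second level $\lim_{|\mathcal P|\to0}\sum_{[s,t]\in\mathcal P}\big(I^1_{u,s}\otimes I^1_{s,t}+F(Y_s)\otimes F(Y_s)\mathbb{Y}_{s,t}\big)$, limits over finite partitions of $[u,v]$. The estimator. $M^T$ denotes the transpose of a matrix $M$; $V=\mathbb{R}^{d\times d}$; $I\otimes X=(\delta^i_jX^k)_{i,j,k=1,\dots,d}$, viewed as the linear map $V\to\mathbb{R}^d$, $G\mapsto GX$; $\mathcal{L}_T\in L(V,V^* )$, $\mathcal{L}_T^{-1}$ is its inverse, and $S_T\in V^*$. The integral $S_T$ is the first-level rough integral against $\mathbf{X}=(1,X,\mathbb{X})$; it is built from $\int_0^TX^i_s\,d_{\mathfrak{R}_1}\mathbf{X}^j=\mathbb{X}^{ij}_{0,T}+X^i_0X^j_{0,T}$. When $\Sigma=\sigma I$ with $\sigma$ a constant, the estimator becomes $\widehat{\Gamma}_T^{T}=-\big(\int_0^TX_s\otimes X_s\,ds\big)^{-1}\big(\int_0^TX_s\otimes d_{\mathfrak{R}_1}\mathbf{X}\big)$, the superscript on $\widehat\Gamma_T^{T}$ denoting transpose. Lifts.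 $\mathbf{B}^{H,\mathrm{Str}}=(1,B^H,\mathbb{B}^{H,\mathrm{Str}})$ is the canonical geometric rough path over $B^H$ (constructed from dyadic approximations of $B^H$ and their iterated integrals), and $\mathbf{B}^{H,\text{It\^o}}=(1,B^H,\mathbb{B}^{H,\text{It\^o}})$ with $\mathbb{B}^{H,\text{It\^o}}_{s,t}=\mathbb{B}^{H,\mathrm{Str}}_{s,t}-(\varphi(t)-\varphi(s))$, where $\varphi(t)=\frac12It^{2H}-H\Gamma\int_0^t\int_0^se^{-\Gamma(s-u)}(s^{2H-1}-(s-u)^{2H-1})\,du\,ds$ and $I$ is the identity matrix. The It\^o rough path enhancement $(X,\mathbb{X})$ of the fOU process is the $X$-block of the unique rough path $\mathbf{Z}$ over $Z_t=(B^H_t,X_t,t)$ solving the rough differential equation $d_{\mathfrak R}\mathbf{Z}=f(Z)\,d_{\mathfrak R}\mathbf{Z}$, $f(x,y,t)(\xi,\eta,\tau)=(\xi,-\Gamma y\tau+\Sigma\xi,\tau)$, when $B^H$ is lifted to $\mathbf{B}^{H,\text{It\^o}}$. *)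

theory Defs
  imports "HOL-Probability.Probability"
begin

section \<open>Partitions and limits as the mesh tends to zero\<close>

text \<open>A partition \<open>u = t 0 < \<dots> < t n = v\<close> is the pair \<open>(n, t)\<close>; the only partition of
  \<open>[u, u]\<close> has \<open>n = 0\<close>.\<close>

definition partitions :: "real \<Rightarrow> real \<Rightarrow> (nat \<times> (nat \<Rightarrow> real)) set" where
  "partitions u v = {(n, t). t 0 = u \<and> t n = v \<and> (\<forall>i<n. t i < t (Suc i))}"

definition psum :: "(real \<Rightarrow> real \<Rightarrow> 'b::comm_monoid_add) \<Rightarrow> nat \<times> (nat \<Rightarrow> real) \<Rightarrow> 'b" where
  "psum \<Xi> P = (\<Sum>i<fst P. \<Xi> (snd P i) (snd P (Suc i)))"

definition mesh_to_0 :: "real \<Rightarrow> real \<Rightarrow> (nat \<times> (nat \<Rightarrow> real)) filter" where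
  "mesh_to_0 u v =
     (INF \<delta>\<in>{0<..}. principal {(n, t). (n, t) \<in> partitions u v \<and> (\<forall>i<n. t (Suc i) - t i < \<delta>)})"


section \<open>Rough paths\<close>

definition tensor :: "real^'a \<Rightarrow> real^'b \<Rightarrow> real^'b^'a" where
  "tensor x y = (\<chi> i j. x $ i * y $ j)"

text \<open>The map \<open>(s, t) \<mapsto> (1, Y\<^sub>s\<^sub>t, YY\<^sub>s\<^sub>t)\<close> without its constant component. Only the values at
  \<open>0 \<le> s < t \<le> T\<close> are meaningful, so everything below must ignore the others; in particular the
  increment over a degenerate interval is set to zero by \<open>lev1\<close>.\<close>

type_synonym 'e two_level = "real \<Rightarrow> real \<Rightarrow> (real^'e) \<times> (real^'e^'e)"

definition lev1 :: "'e two_level \<Rightarrow> real \<Rightarrow> real \<Rightarrow> real^'e" where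
  "lev1 Y s t = (if s < t then fst (Y s t) else 0)"

text \<open>A rough path only contains increments; the underlying path is recovered from its
  starting point.\<close>

definition path_from :: "real^'e \<Rightarrow> 'e two_level \<Rightarrow> real \<Rightarrow> real^'e" where
  "path_from y0 Y t = y0 + lev1 Y 0 t"

definition control :: "real \<Rightarrow> (real \<Rightarrow> real \<Rightarrow> real) \<Rightarrow> bool" where
  "control T \<omega> \<longleftrightarrow>
     (\<forall>s t. 0 \<le> s \<and> s \<le> t \<and> t \<le> T \<longrightarrow> 0 \<le> \<omega> s t) \<and>
     continuous_on {(s, t). 0 \<le> s \<and> s \<le> t \<and> t \<le> T} (\<lambda>(s, t). \<omega> s t) \<and>
     (\<forall>s u t. 0 \<le> s \<and> s \<le> u \<and> u \<le> t \<and> t \<le> T \<longrightarrow> \<omega> s u + \<omega> u t \<le> \<omega> s t) \<and>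
     (\<forall>t. 0 \<le> t \<and> t \<le> T \<longrightarrow> \<omega> t t = 0)"

definition rough_paths :: "real \<Rightarrow> real \<Rightarrow> ('e::finite) two_level set" where
  "rough_paths p T = {Y.
     (\<exists>y. continuous_on {0..T} y \<and>
          (\<forall>s t. 0 \<le> s \<and> s < t \<and> t \<le> T \<longrightarrow> fst (Y s t) = y t - y s)) \<and>
     (\<forall>s u t. 0 \<le> s \<and> s < u \<and> u < t \<and> t \<le> T \<longrightarrow>
          snd (Y s t) - snd (Y s u) - snd (Y u t) = tensor (fst (Y s u)) (fst (Y u t))) \<and>
     (\<exists>\<omega>. control T \<omega> \<and>
          (\<forall>s t. 0 \<le> s \<and> s < t \<and> t \<le> T \<longrightarrow>
             norm (fst (Y s t)) \<le> \<omega> s t powr (1 / p) \<and>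
             norm (snd (Y s t)) \<le> \<omega> s t powr (2 / p)))}"

definition pvar :: "real \<Rightarrow> real \<Rightarrow> (real \<Rightarrow> real \<Rightarrow> 'b::real_normed_vector) \<Rightarrow> ennreal" where
  "pvar q T A =
     (SUP P\<in>partitions 0 T. ennreal (psum (\<lambda>s t. norm (A s t) powr q) P powr (1 / q)))"

definition dp :: "real \<Rightarrow> real \<Rightarrow> ('e::finite) two_level \<Rightarrow> 'e two_level \<Rightarrow> ennreal" where
  "dp p T X Y = max (pvar p T (\<lambda>s t. fst (X s t) - fst (Y s t)))
                    (pvar (p / 2) T (\<lambda>s t. snd (X s t) - snd (Y s t)))"


section \<open>Rough integrals\<close>

text \<open>\<open>DF(y)\<close> is bilinear in (direction, argument of \<open>F\<close>), and a matrix is contracted with it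
  so that \<open>x \<otimes> z\<close> is sent to \<open>DF(y)(x)(z)\<close>.\<close>

definition DF_contract ::
  "(real^'e \<Rightarrow> (real^'e) \<Rightarrow>\<^sub>L 'w::real_normed_vector) \<Rightarrow> real^'e \<Rightarrow> real^'e^'e \<Rightarrow> 'w" where
  "DF_contract F y A =
     (\<Sum>i\<in>UNIV. \<Sum>j\<in>UNIV. A $ i $ j *\<^sub>R
        blinfun_apply (frechet_derivative F (at y) (axis i 1)) (axis j 1))"

definition has_rough_integral1 ::
  "(real^'e \<Rightarrow> (real^'e) \<Rightarrow>\<^sub>L 'w::real_normed_vector) \<Rightarrow> real^'e \<Rightarrow> ('e::finite) two_level
     \<Rightarrow> real \<Rightarrow> real \<Rightarrow> 'w \<Rightarrow> bool" where
  "has_rough_integral1 F y0 Y u v I \<longleftrightarrow>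
     (psum (\<lambda>s t. blinfun_apply (F (path_from y0 Y s)) (fst (Y s t))
                   + DF_contract F (path_from y0 Y s) (snd (Y s t))) \<longlongrightarrow> I) (mesh_to_0 u v)"

definition rough_integral1 ::
  "(real^'e \<Rightarrow> (real^'e) \<Rightarrow>\<^sub>L 'w::real_normed_vector) \<Rightarrow> real^'e \<Rightarrow> ('e::finite) two_level
     \<Rightarrow> real \<Rightarrow> real \<Rightarrow> 'w" where
  "rough_integral1 F y0 Y u v = (THE I. has_rough_integral1 F y0 Y u v I)"

definition map_tensor2 :: "((real^'e) \<Rightarrow>\<^sub>L (real^'m)) \<Rightarrow> real^'e^'e \<Rightarrow> real^'m^'m" where
  "map_tensor2 A M = (\<Sum>i\<in>UNIV. \<Sum>j\<in>UNIV. M $ i $ j *\<^sub>R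
     tensor (blinfun_apply A (axis i 1)) (blinfun_apply A (axis j 1)))"

definition has_rough_integral ::
  "real \<Rightarrow> (real^'e \<Rightarrow> (real^'e) \<Rightarrow>\<^sub>L (real^'m)) \<Rightarrow> real^'e \<Rightarrow> ('e::finite) two_level
     \<Rightarrow> ('m::finite) two_level \<Rightarrow> bool" where
  "has_rough_integral T F y0 Y W \<longleftrightarrow>
     (\<forall>u v. 0 \<le> u \<and> u < v \<and> v \<le> T \<longrightarrow>
        has_rough_integral1 F y0 Y u v (fst (W u v)) \<and>
        (psum (\<lambda>s t. tensor (lev1 W u s) (fst (W s t))
                      + map_tensor2 (F (path_from y0 Y s)) (snd (Y s t)))
           \<longlongrightarrow> snd (W u v)) (mesh_to_0 u v))"


section \<open>Fractional Brownian motion and its lifts\<close>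

text \<open>Constants are degenerate Gaussian variables.\<close>

definition centred_gaussian :: "'a measure \<Rightarrow> ('a \<Rightarrow> real) \<Rightarrow> bool" where
  "centred_gaussian M Y \<longleftrightarrow>
     Y \<in> borel_measurable M \<and>
     ((AE \<omega> in M. Y \<omega> = 0) \<or> (\<exists>\<sigma>>0. distributed M lborel Y (normal_density 0 \<sigma>)))"

definition fBm :: "'a measure \<Rightarrow> real \<Rightarrow> real \<Rightarrow> (real \<Rightarrow> 'a \<Rightarrow> real^('d::finite)) \<Rightarrow> bool" where
  "fBm M H T B \<longleftrightarrow>
     prob_space M \<and>
     (\<forall>t\<in>{0..T}. B t \<in> borel_measurable M) \<and>
     (AE \<omega> in M. continuous_on {0..T} (\<lambda>t. B t \<omega>)) \<and>
     (\<forall>i S c. finite S \<and> S \<subseteq> {0..T} \<longrightarrow>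
        centred_gaussian M (\<lambda>\<omega>. \<Sum>t\<in>S. c t * B t \<omega> $ i)) \<and>
     prob_space.indep_vars M (\<lambda>i. \<Pi>\<^sub>M t\<in>{0..T}. borel)
        (\<lambda>i \<omega>. \<lambda>t\<in>{0..T}. B t \<omega> $ i) UNIV \<and>
     (\<forall>i. \<forall>s\<in>{0..T}. \<forall>u\<in>{0..T}.
        prob_space.expectation M (\<lambda>\<omega>. B s \<omega> $ i * B u \<omega> $ i)
          = (u powr (2 * H) + s powr (2 * H) - \<bar>u - s\<bar> powr (2 * H)) / 2)"

definition dyadic_interp :: "real \<Rightarrow> nat \<Rightarrow> (real \<Rightarrow> real^'d) \<Rightarrow> real \<Rightarrow> real^'d" where
  "dyadic_interp T n b t =
     (let h = T / 2 ^ n; k = of_int \<lfloor>t / h\<rfloor>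
      in b (k * h) + (t / h - k) *\<^sub>R (b ((k + 1) * h) - b (k * h)))"

text \<open>The iterated integral \<open>\<integral>(w\<^sub>u - w\<^sub>s) \<otimes> dw\<^sub>u\<close> of a piecewise smooth path.\<close>

definition smooth_lift :: "(real \<Rightarrow> real^'d) \<Rightarrow> ('d::finite) two_level" where
  "smooth_lift w s t =
     (w t - w s, integral {s..t} (\<lambda>u. tensor (w u - w s) (vector_derivative w (at u))))"

definition canonical_lift ::
  "'a measure \<Rightarrow> real \<Rightarrow> real \<Rightarrow> (real \<Rightarrow> 'a \<Rightarrow> real^('d::finite)) \<Rightarrow> ('a \<Rightarrow> 'd two_level) \<Rightarrow> bool"
where
  "canonical_lift M p T B BB \<longleftrightarrow>
     (AE \<omega> in M. BB \<omega> \<in> rough_paths p T \<and>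
        (\<forall>s t. 0 \<le> s \<and> s < t \<and> t \<le> T \<longrightarrow> fst (BB \<omega> s t) = B t \<omega> - B s \<omega>) \<and>
        (\<lambda>n. dp p T (smooth_lift (dyadic_interp T n (\<lambda>t. B t \<omega>))) (BB \<omega>)) \<longlonglongrightarrow> 0)"

text \<open>On \<open>real^'d^'d\<close> the operation \<open>*\<close> is entrywise and no matrix exponential is available.\<close>

definition mat_exp :: "real^'d^'d \<Rightarrow> real^'d^'d" where
  "mat_exp A = (\<Sum>k. (1 / fact k) *\<^sub>R (((\<lambda>N. A ** N) ^^ k) (mat 1)))"

definition ito_correction :: "real \<Rightarrow> real^'d^'d \<Rightarrow> real \<Rightarrow> real^'d^'d" where
  "ito_correction H \<Gamma> t =
     (t powr (2 * H) / 2) *\<^sub>R mat 1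
     - H *\<^sub>R (\<Gamma> ** integral {0..t} (\<lambda>s. integral {0..s} (\<lambda>u.
          (s powr (2 * H - 1) - (s - u) powr (2 * H - 1)) *\<^sub>R mat_exp (- (s - u) *\<^sub>R \<Gamma>))))"

definition ito_lift :: "real \<Rightarrow> real^'d^'d \<Rightarrow> ('d::finite) two_level \<Rightarrow> 'd two_level" where
  "ito_lift H \<Gamma> bb s t =
     (fst (bb s t), snd (bb s t) - (ito_correction H \<Gamma> t - ito_correction H \<Gamma> s))"


section \<open>The fractional Ornstein-Uhlenbeck process and its Ito enhancement\<close>

definition fOU ::
  "'a measure \<Rightarrow> real \<Rightarrow> real^'d^'d \<Rightarrow> real^'d^'d \<Rightarrow> real^'d
     \<Rightarrow> (real \<Rightarrow> 'a \<Rightarrow> real^('d::finite)) \<Rightarrow> (real \<Rightarrow> 'a \<Rightarrow> real^'d) \<Rightarrow> bool" where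
  "fOU M T \<Gamma> \<Sigma> x0 B X \<longleftrightarrow>
     (AE \<omega> in M. continuous_on {0..T} (\<lambda>t. X t \<omega>) \<and> X 0 \<omega> = x0 \<and>
        (\<forall>t\<in>{0..T}. X t \<omega> - X 0 \<omega> =
            - integral {0..t} (\<lambda>s. \<Gamma> *v X s \<omega>) + \<Sigma> *v (B t \<omega> - B 0 \<omega>)))"

text \<open>Coordinates of \<open>(x, y, t)\<close>: \<open>Inl i\<close> for \<open>x\<close>, \<open>Inr (Inl i)\<close> for \<open>y\<close>, \<open>Inr (Inr ())\<close> for \<open>t\<close>.\<close>

definition join :: "real^('d::finite) \<Rightarrow> real^'d \<Rightarrow> real \<Rightarrow> real^('d + 'd + unit)" where
  "join x y t = (\<chi> k. case k of Inl i \<Rightarrow> x $ i | Inr (Inl i) \<Rightarrow> y $ i | Inr (Inr _) \<Rightarrow> t)"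

definition fst_part :: "real^(('d::finite) + 'd + unit) \<Rightarrow> real^'d" where
  "fst_part z = (\<chi> i. z $ Inl i)"

definition snd_part :: "real^(('d::finite) + 'd + unit) \<Rightarrow> real^'d" where
  "snd_part z = (\<chi> i. z $ Inr (Inl i))"

definition time_part :: "real^(('d::finite) + 'd + unit) \<Rightarrow> real" where
  "time_part z = z $ Inr (Inr ())"

lift_definition fOU_field ::
  "real^'d^'d \<Rightarrow> real^'d^'d \<Rightarrow> real^('d + 'd + unit)
     \<Rightarrow> (real^('d + 'd + unit)) \<Rightarrow>\<^sub>L (real^(('d::finite) + 'd + unit))"
  is "\<lambda>\<Gamma> \<Sigma> z h.
        join (fst_part h)
             (- (time_part h *\<^sub>R (\<Gamma> *v snd_part z)) + \<Sigma> *v fst_part h)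
             (time_part h)"
  proof -
  fix \<Gamma> \<Sigma> :: "real^'d^'d" and z :: "real^('d + 'd + unit)"
  have "linear (\<lambda>h. join (fst_part h)
      (- (time_part h *\<^sub>R (\<Gamma> *v snd_part z)) + \<Sigma> *v fst_part h) (time_part h))"
    by (rule linearI)
       (auto simp: vec_eq_iff join_def fst_part_def snd_part_def time_part_def
          matrix_vector_mult_def algebra_simps sum.distrib sum_distrib_left split: sum.splits)
  then show "bounded_linear (\<lambda>h. join (fst_part h)
      (- (time_part h *\<^sub>R (\<Gamma> *v snd_part z)) + \<Sigma> *v fst_part h) (time_part h))"
    by (rule linear_conv_bounded_linear[THEN iffD1])
qed

text \<open>The equation leaves the pairings of \<open>B\<close> with time undetermined; they are the
  Young (here elementary) integrals, so that the driver is the joint lift of time and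
  the Ito lift of \<open>B\<close>, and the solution is unique.\<close>

definition ito_rde_solution ::
  "real \<Rightarrow> real \<Rightarrow> real \<Rightarrow> real^'d^'d \<Rightarrow> real^'d^'d \<Rightarrow> (real \<Rightarrow> real^'d) \<Rightarrow> ('d::finite) two_level
     \<Rightarrow> (real \<Rightarrow> real^'d) \<Rightarrow> ('d + 'd + unit) two_level \<Rightarrow> bool" where
  "ito_rde_solution p T H \<Gamma> \<Sigma> b bb x Z \<longleftrightarrow>
     Z \<in> rough_paths p T \<and>
     (\<forall>s t. 0 \<le> s \<and> s < t \<and> t \<le> T \<longrightarrow>
        fst (Z s t) = join (b t) (x t) t - join (b s) (x s) s \<and>
        (\<forall>i j. snd (Z s t) $ Inl i $ Inl j = snd (ito_lift H \<Gamma> bb s t) $ i $ j) \<and>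
        (\<forall>i. snd (Z s t) $ Inl i $ Inr (Inr ()) = integral {s..t} (\<lambda>u. b u $ i - b s $ i)) \<and>
        (\<forall>i. snd (Z s t) $ Inr (Inr ()) $ Inl i =
               (t - s) * (b t $ i - b s $ i) - integral {s..t} (\<lambda>u. b u $ i - b s $ i)) \<and>
        snd (Z s t) $ Inr (Inr ()) $ Inr (Inr ()) = (t - s)\<^sup>2 / 2) \<and>
     has_rough_integral T (fOU_field \<Gamma> \<Sigma>) (join (b 0) (x 0) 0) Z Z"

definition ito_enhancement ::
  "'a measure \<Rightarrow> real \<Rightarrow> real \<Rightarrow> real \<Rightarrow> real^'d^'d \<Rightarrow> real^'d^'d
     \<Rightarrow> (real \<Rightarrow> 'a \<Rightarrow> real^('d::finite)) \<Rightarrow> ('a \<Rightarrow> 'd two_level)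
     \<Rightarrow> (real \<Rightarrow> 'a \<Rightarrow> real^'d) \<Rightarrow> ('a \<Rightarrow> 'd two_level) \<Rightarrow> bool" where
  "ito_enhancement M p T H \<Gamma> \<Sigma> B BB X XX \<longleftrightarrow>
     (AE \<omega> in M. \<exists>Z.
        ito_rde_solution p T H \<Gamma> \<Sigma> (\<lambda>t. B t \<omega>) (BB \<omega>) (\<lambda>t. X t \<omega>) Z \<and>
        (\<forall>s t. 0 \<le> s \<and> s < t \<and> t \<le> T \<longrightarrow>
           XX \<omega> s t = (snd_part (fst (Z s t)),
                       \<chi> i j. snd (Z s t) $ Inr (Inl i) $ Inr (Inl j))))"


section \<open>The estimator\<close>

text \<open>\<open>V\<^sup>*\<close> is the space of bounded functionals on \<open>V\<close> = \<open>real^'d^'d\<close>, and \<open>real^'d\<close> is identified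
  with its own dual by the inner product.\<close>

lift_definition I_tensor :: "real^'d \<Rightarrow> (real^'d^('d::finite)) \<Rightarrow>\<^sub>L (real^'d)"
  is "\<lambda>x G. G *v x"
  by (rule linear_conv_bounded_linear[THEN iffD1], rule linearI)
     (auto simp: vec_eq_iff matrix_vector_mult_def algebra_simps sum.distrib sum_distrib_left)

lift_definition mat_blinfun :: "real^'d^'d \<Rightarrow> (real^'d) \<Rightarrow>\<^sub>L (real^('d::finite))"
  is "\<lambda>A \<xi>. A *v \<xi>"
  by (rule matrix_vector_mul_bounded_linear)

lift_definition blinfun_transp ::
  "('v::real_normed_vector) \<Rightarrow>\<^sub>L (real^('d::finite)) \<Rightarrow> (real^'d) \<Rightarrow>\<^sub>L ('v \<Rightarrow>\<^sub>L real)"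
  is "\<lambda>A \<xi>. blinfun_inner_left \<xi> o\<^sub>L A"
  by (rule linear_conv_bounded_linear[THEN iffD1], rule linearI)
     (auto intro!: blinfun_eqI
        simp: algebra_simps inner_simps plus_blinfun.rep_eq scaleR_blinfun.rep_eq)

definition S_form :: "real^'d^'d \<Rightarrow> real^'d \<Rightarrow> (real^'d) \<Rightarrow>\<^sub>L ((real^'d^('d::finite)) \<Rightarrow>\<^sub>L real)" where
  "S_form Q x = blinfun_transp (I_tensor x) o\<^sub>L mat_blinfun (matrix_inv Q)"

definition L_op :: "real^'d^'d \<Rightarrow> real^'d \<Rightarrow> real \<Rightarrow> ('d::finite) two_level
    \<Rightarrow> (real^'d^'d) \<Rightarrow>\<^sub>L ((real^'d^'d) \<Rightarrow>\<^sub>L real)" where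
  "L_op Q x0 T X =
     integral {0..T} (\<lambda>s. S_form Q (path_from x0 X s) o\<^sub>L I_tensor (path_from x0 X s))"

definition S_vec :: "real^'d^'d \<Rightarrow> real^'d \<Rightarrow> real \<Rightarrow> ('d::finite) two_level
    \<Rightarrow> (real^'d^'d) \<Rightarrow>\<^sub>L real" where
  "S_vec Q x0 T X = rough_integral1 (S_form Q) x0 X 0 T"

text \<open>The rough paths at which the inverse of the operator in the estimator exists.\<close>

definition estimator_domain ::
  "real \<Rightarrow> real^'d^'d \<Rightarrow> real^'d \<Rightarrow> real \<Rightarrow> ('d::finite) two_level set" where
  "estimator_domain p \<Sigma> x0 T =
     {X \<in> rough_paths p T. bij (blinfun_apply (L_op (\<Sigma> ** transpose \<Sigma>) x0 T X))}"

definition drift_estimator ::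
  "real^'d^'d \<Rightarrow> real^'d \<Rightarrow> real \<Rightarrow> ('d::finite) two_level \<Rightarrow> real^'d^'d" where
  "drift_estimator \<Sigma> x0 T X =
     - inv (blinfun_apply (L_op (\<Sigma> ** transpose \<Sigma>) x0 T X)) (S_vec (\<Sigma> ** transpose \<Sigma>) x0 T X)"

end

theory Submission
  imports Defs
begin

text \<open>Continuity rests on the fact that the one-form \<open>S_form Q\<close> is \<^emph>\<open>linear\<close> in the base point. For a
bounded linear one-form \<open>F\<close> Chen's identity makes each summand of the compensated Riemann sum an
exact increment, so every sum telescopes to the same value
\<open>DF(y\<^sub>0 \<otimes> Y\<^sub>0\<^sub>T + YY\<^sub>0\<^sub>T)\<close>, for every rough path and every partition
(\<open>rough_integral_bounded_linear\<close>). Hence \<open>S_vec\<close> is a linear function of the two levels over the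
single interval \<open>[0, T]\<close>, and these are controlled by the \<open>p\<close>-variation distance through the
one-interval partition. The partition \<open>{0, s, T}\<close> controls the path at time \<open>s\<close>, uniformly in \<open>s\<close>,
so that \<open>L_op\<close>, the time integral of a quadratic function of the path, is continuous as well. In
finite dimensions bijectivity is an open condition and the solution of a linear system depends
continuously on its data (\<open>blinfun_solution_stable\<close>); this gives continuity of the estimator.

It remains to see that almost every enhanced path lies in the domain. The enhancement is a
coordinate block of the rough path \<open>Z\<close>, hence itself a rough path. For \<open>L_op\<close>, the quadratic
form \<open>G \<mapsto> \<integral> (G X\<^sub>s) \<bullet> Q\<^sup>-\<^sup>1 (G X\<^sub>s) ds\<close> vanishes only if \<open>G X\<^sub>s = 0\<close> for all \<open>s\<close>, so it has to be shown
that almost surely no vector \<open>v \<noteq> 0\<close> is orthogonal to the whole path \<open>X\<close>. If \<open>v\<close> is, the equation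
for \<open>X\<close> says that \<open>w \<bullet> B\<close> is Lipschitz for \<open>w = \<Sigma>\<^sup>T v\<close>. This is excluded simultaneously for all
\<open>w \<noteq> 0\<close> by one almost sure event: on uniform grids the matrix of rescaled quadratic covariations of \<open>B\<close>
tends to the identity in \<open>L\<^sup>2\<close>, thus almost surely along a subsequence, whereas a Lipschitz
projection would force \<open>w \<bullet> w = 0\<close> in the limit (\<open>fBm_no_lipschitz_projection\<close>). The \<open>L\<^sup>2\<close> bound comes
from the fourth moments of Gaussian variables and from the fact that, for \<open>H \<le> 1/2\<close>,
increments over disjoint intervals are never positively correlated.\<close>

section \<open>Moments of fractional Brownian increments\<close>

lemma centred_gaussian_moments:
  assumes "centred_gaussian M Y"
  shows "integrable M (\<lambda>\<omega>. Y \<omega> ^ 2)" "integrable M (\<lambda>\<omega>. Y \<omega> ^ 4)"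
    and "(\<integral>\<omega>. Y \<omega> ^ 4 \<partial>M) = 3 * (\<integral>\<omega>. Y \<omega> ^ 2 \<partial>M)\<^sup>2"
proof -
  have meas [measurable]: "Y \<in> borel_measurable M"
    using assms by (simp add: centred_gaussian_def)
  consider "AE \<omega> in M. Y \<omega> = 0" | \<sigma> where "\<sigma> > 0" "distributed M lborel Y (normal_density 0 \<sigma>)"
    using assms by (auto simp: centred_gaussian_def)
  then have "integrable M (\<lambda>\<omega>. Y \<omega> ^ 2) \<and> integrable M (\<lambda>\<omega>. Y \<omega> ^ 4) \<and>
    (\<integral>\<omega>. Y \<omega> ^ 4 \<partial>M) = 3 * (\<integral>\<omega>. Y \<omega> ^ 2 \<partial>M)\<^sup>2"
  proof cases
    case 1
    have z: "integrable M (\<lambda>\<omega>. Y \<omega> ^ k) \<and> (\<integral>\<omega>. Y \<omega> ^ k \<partial>M) = 0" if "k > 0" for k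
    proof -
      have ae: "AE \<omega> in M. Y \<omega> ^ k = 0"
        using 1 by eventually_elim (use that in simp)
      show ?thesis
        using integrable_cong_AE[of "\<lambda>\<omega>. Y \<omega> ^ k" M "\<lambda>_. 0"] 
          integral_cong_AE[of "\<lambda>\<omega>. Y \<omega> ^ k" M "\<lambda>_. 0"] ae by simp
    qed
    show ?thesis using z[of 2] z[of 4] by simp
  next
    case 2
    have m: "integrable M (\<lambda>\<omega>. Y \<omega> ^ (2*k)) \<and>
        (\<integral>\<omega>. Y \<omega> ^ (2*k) \<partial>M) = fact (2 * k) / ((2 / \<sigma>\<^sup>2)^k * fact k)" for k
    proof -
      have "has_bochner_integral lborel (\<lambda>x. normal_density 0 \<sigma> x * x ^ (2 * k))
          (fact (2 * k) / ((2 / \<sigma>\<^sup>2)^k * fact k))"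
        using normal_moment_even[OF 2(1), of 0 k] by simp
      then show ?thesis
        using distributed_integral[OF 2(2), of "\<lambda>x. x ^ (2*k)"]
          distributed_integrable[OF 2(2), of "\<lambda>x. x ^ (2*k)"]
        by (simp add: has_bochner_integral_iff)
    qed
    show ?thesis using m[of 1] m[of 2] 2(1)
      by (simp add: fact_numeral field_simps eval_nat_numeral)
  qed
  then show "integrable M (\<lambda>\<omega>. Y \<omega> ^ 2)" "integrable M (\<lambda>\<omega>. Y \<omega> ^ 4)"
    "(\<integral>\<omega>. Y \<omega> ^ 4 \<partial>M) = 3 * (\<integral>\<omega>. Y \<omega> ^ 2 \<partial>M)\<^sup>2"
    by auto
qed

text \<open>Polarisation turns the mixed moments into second and fourth moments of \<open>U\<close>, \<open>V\<close>, \<open>U + V\<close> and \<open>U - V\<close>,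
so the case of Isserlis' theorem that is needed follows without a joint density.\<close>

lemma gaussian_pair_moments:
  assumes "centred_gaussian M U" "centred_gaussian M V"
    and "centred_gaussian M (\<lambda>\<omega>. U \<omega> + V \<omega>)" "centred_gaussian M (\<lambda>\<omega>. U \<omega> - V \<omega>)"
  shows "integrable M (\<lambda>\<omega>. U \<omega> * V \<omega>)" "integrable M (\<lambda>\<omega>. U \<omega> ^ 2 * V \<omega> ^ 2)"
    and "(\<integral>\<omega>. U \<omega> ^ 2 * V \<omega> ^ 2 \<partial>M) =
      (\<integral>\<omega>. U \<omega> ^ 2 \<partial>M) * (\<integral>\<omega>. V \<omega> ^ 2 \<partial>M) + 2 * (\<integral>\<omega>. U \<omega> * V \<omega> \<partial>M)\<^sup>2"
proof -
  note mU = centred_gaussian_moments[OF assms(1)]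
    and mV = centred_gaussian_moments[OF assms(2)]
    and mp = centred_gaussian_moments[OF assms(3)]
    and mm = centred_gaussian_moments[OF assms(4)]
  have pol2: "U \<omega> * V \<omega> = ((U \<omega> + V \<omega>) ^ 2 - (U \<omega> - V \<omega>) ^ 2) / 4" for \<omega>
    by (simp add: power2_eq_square algebra_simps)
  have pol4: "U \<omega> ^ 2 * V \<omega> ^ 2 =
      ((U \<omega> + V \<omega>) ^ 4 + (U \<omega> - V \<omega>) ^ 4 - 2 * U \<omega> ^ 4 - 2 * V \<omega> ^ 4) / 12" for \<omega>
    by (simp add: eval_nat_numeral algebra_simps)
  show i: "integrable M (\<lambda>\<omega>. U \<omega> * V \<omega>)"
    unfolding pol2 using mp mm by simp
  show "integrable M (\<lambda>\<omega>. U \<omega> ^ 2 * V \<omega> ^ 2)"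
    unfolding pol4 using mp mm mU mV by simp
  define a b c where "a = (\<integral>\<omega>. U \<omega> ^ 2 \<partial>M)" "b = (\<integral>\<omega>. V \<omega> ^ 2 \<partial>M)" "c = (\<integral>\<omega>. U \<omega> * V \<omega> \<partial>M)"
  have "(\<integral>\<omega>. (U \<omega> + V \<omega>) ^ 2 \<partial>M) = (\<integral>\<omega>. U \<omega> ^ 2 + V \<omega> ^ 2 + 2 * (U \<omega> * V \<omega>) \<partial>M)"
    by (rule Bochner_Integration.integral_cong) (auto simp: power2_eq_square algebra_simps)
  also have "\<dots> = a + b + 2 * c"
    using mU mV i by (simp add: a_b_c_def)
  finally have p2: "(\<integral>\<omega>. (U \<omega> + V \<omega>) ^ 2 \<partial>M) = a + b + 2 * c" .
  have "(\<integral>\<omega>. (U \<omega> - V \<omega>) ^ 2 \<partial>M) = (\<integral>\<omega>. U \<omega> ^ 2 + V \<omega> ^ 2 - 2 * (U \<omega> * V \<omega>) \<partial>M)"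
    by (rule Bochner_Integration.integral_cong) (auto simp: power2_eq_square algebra_simps)
  also have "\<dots> = a + b - 2 * c"
    using mU mV i by (simp add: a_b_c_def)
  finally have m2: "(\<integral>\<omega>. (U \<omega> - V \<omega>) ^ 2 \<partial>M) = a + b - 2 * c" .
  have "(\<integral>\<omega>. U \<omega> ^ 2 * V \<omega> ^ 2 \<partial>M) =
      (3 * (a + b + 2 * c)\<^sup>2 + 3 * (a + b - 2 * c)\<^sup>2 - 2 * (3 * a\<^sup>2) - 2 * (3 * b\<^sup>2)) / 12"
    unfolding pol4 using mp mm mU mV by (simp add: p2 m2 a_b_c_def)
  also have "\<dots> = a * b + 2 * c\<^sup>2"
    by (simp add: power2_eq_square algebra_simps)
  finally show "(\<integral>\<omega>. U \<omega> ^ 2 * V \<omega> ^ 2 \<partial>M) =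
      (\<integral>\<omega>. U \<omega> ^ 2 \<partial>M) * (\<integral>\<omega>. V \<omega> ^ 2 \<partial>M) + 2 * (\<integral>\<omega>. U \<omega> * V \<omega> \<partial>M)\<^sup>2"
    by (simp add: a_b_c_def)
qed

lemma fBm_linear_combination:
  assumes "fBm M H T B" "finite S" "S \<subseteq> {0..T}"
  shows "centred_gaussian M (\<lambda>\<omega>. \<Sum>t\<in>S. c t * B t \<omega> $ i)"
proof -
  have "\<forall>i S c. finite S \<and> S \<subseteq> {0..T} \<longrightarrow> centred_gaussian M (\<lambda>\<omega>. \<Sum>t\<in>S. c t * B t \<omega> $ i)"
    using assms(1) by (simp add: fBm_def)
  with assms(2,3) show ?thesis by simp
qed

lemma fBm_covariance:
  assumes "fBm M H T B" "s \<in> {0..T}" "u \<in> {0..T}"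
  shows "(\<integral>\<omega>. B s \<omega> $ i * B u \<omega> $ i \<partial>M) = (u powr (2 * H) + s powr (2 * H) - \<bar>u - s\<bar> powr (2 * H)) / 2"
proof -
  have "\<forall>i. \<forall>s\<in>{0..T}. \<forall>u\<in>{0..T}. (\<integral>\<omega>. B s \<omega> $ i * B u \<omega> $ i \<partial>M) =
      (u powr (2 * H) + s powr (2 * H) - \<bar>u - s\<bar> powr (2 * H)) / 2"
    using assms(1) by (simp add: fBm_def)
  with assms(2,3) show ?thesis by simp
qed

text \<open>The coefficients are sums of indicators of the four times, so that no case distinction
is needed when some of the times coincide.\<close>

lemma fBm_increments_gaussian:
  assumes B: "fBm M H T B" and t: "{a, b, c, e} \<subseteq> {0..T}"
  shows "centred_gaussian M (\<lambda>\<omega>. (B b \<omega> $ i - B a \<omega> $ i) + \<alpha> * (B e \<omega> $ i - B c \<omega> $ i))"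
proof -
  define w where
    "w t = (of_bool (t = b) - of_bool (t = a)) + \<alpha> * (of_bool (t = e) - of_bool (t = c))" for t :: real
  have pick: "(\<Sum>t\<in>S. of_bool (t = z) * f t) = f z" if "z \<in> S" "finite S"
    for S and z :: real and f :: "real \<Rightarrow> real"
    using that by (subst sum.mono_neutral_right[of _ "{z}"]) auto
  have "(\<Sum>t\<in>{a, b, c, e}. w t * f t) = (f b - f a) + \<alpha> * (f e - f c)" for f :: "real \<Rightarrow> real"
  proof -
    have "(\<Sum>t\<in>{a, b, c, e}. w t * f t) =
        ((\<Sum>t\<in>{a, b, c, e}. of_bool (t = b) * f t) - (\<Sum>t\<in>{a, b, c, e}. of_bool (t = a) * f t))
        + \<alpha> * ((\<Sum>t\<in>{a, b, c, e}. of_bool (t = e) * f t) - (\<Sum>t\<in>{a, b, c, e}. of_bool (t = c) * f t))"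
      unfolding w_def sum_distrib_left sum_subtractf[symmetric] sum.distrib[symmetric]
      by (rule sum.cong) (auto simp: algebra_simps)
    also have "\<dots> = (f b - f a) + \<alpha> * (f e - f c)"
      by (subst (1 2 3 4) pick) auto
    finally show ?thesis .
  qed
  then show ?thesis
    using fBm_linear_combination[OF B _ t, of w i] by simp
qed

lemma fBm_increment_moments:
  assumes B: "fBm M H T B" and t: "{a, b, c, e} \<subseteq> {0..T}"
  shows "integrable M (\<lambda>\<omega>. (B b \<omega> $ i - B a \<omega> $ i) * (B e \<omega> $ i - B c \<omega> $ i))"
    and "integrable M (\<lambda>\<omega>. (B b \<omega> $ i - B a \<omega> $ i)\<^sup>2 * (B e \<omega> $ i - B c \<omega> $ i)\<^sup>2)"
    and "(\<integral>\<omega>. (B b \<omega> $ i - B a \<omega> $ i)\<^sup>2 * (B e \<omega> $ i - B c \<omega> $ i)\<^sup>2 \<partial>M) =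
      (\<integral>\<omega>. (B b \<omega> $ i - B a \<omega> $ i)\<^sup>2 \<partial>M) * (\<integral>\<omega>. (B e \<omega> $ i - B c \<omega> $ i)\<^sup>2 \<partial>M)
      + 2 * (\<integral>\<omega>. (B b \<omega> $ i - B a \<omega> $ i) * (B e \<omega> $ i - B c \<omega> $ i) \<partial>M)\<^sup>2"
proof -
  have g: "centred_gaussian M (\<lambda>\<omega>. B b \<omega> $ i - B a \<omega> $ i)"
    using fBm_increments_gaussian[OF assms, of i 0] by simp
  have g': "centred_gaussian M (\<lambda>\<omega>. B e \<omega> $ i - B c \<omega> $ i)"
    using fBm_increments_gaussian[OF B, of c e a b i 0] t by simp
  have p: "centred_gaussian M (\<lambda>\<omega>. (B b \<omega> $ i - B a \<omega> $ i) + (B e \<omega> $ i - B c \<omega> $ i))"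
    using fBm_increments_gaussian[OF assms, of i 1] by simp
  have m: "centred_gaussian M (\<lambda>\<omega>. (B b \<omega> $ i - B a \<omega> $ i) - (B e \<omega> $ i - B c \<omega> $ i))"
    using fBm_increments_gaussian[OF assms, of i "-1"]
    by (simp add: algebra_simps)
  note * = gaussian_pair_moments[OF g g' p m]
  show "integrable M (\<lambda>\<omega>. (B b \<omega> $ i - B a \<omega> $ i) * (B e \<omega> $ i - B c \<omega> $ i))"
    "integrable M (\<lambda>\<omega>. (B b \<omega> $ i - B a \<omega> $ i)\<^sup>2 * (B e \<omega> $ i - B c \<omega> $ i)\<^sup>2)"
    "(\<integral>\<omega>. (B b \<omega> $ i - B a \<omega> $ i)\<^sup>2 * (B e \<omega> $ i - B c \<omega> $ i)\<^sup>2 \<partial>M) =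
      (\<integral>\<omega>. (B b \<omega> $ i - B a \<omega> $ i)\<^sup>2 \<partial>M) * (\<integral>\<omega>. (B e \<omega> $ i - B c \<omega> $ i)\<^sup>2 \<partial>M)
      + 2 * (\<integral>\<omega>. (B b \<omega> $ i - B a \<omega> $ i) * (B e \<omega> $ i - B c \<omega> $ i) \<partial>M)\<^sup>2"
    using * by auto
qed

lemma fBm_value_product_integrable:
  assumes B: "fBm M H T B" and t: "s \<in> {0..T}" "u \<in> {0..T}"
  shows "integrable M (\<lambda>\<omega>. B s \<omega> $ i * B u \<omega> $ i)"
proof -
  have sq: "integrable M (\<lambda>\<omega>. (\<Sum>r\<in>S. c r * B r \<omega> $ i)\<^sup>2)" if "finite S" "S \<subseteq> {0..T}" for S c
    by (rule centred_gaussian_moments(1)[OF fBm_linear_combination[OF B that]])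
  show ?thesis
  proof (cases "s = u")
    case True
    then show ?thesis using sq[of "{s}" "\<lambda>_. 1"] t by (simp add: power2_eq_square)
  next
    case False
    have "integrable M (\<lambda>\<omega>. ((B s \<omega> $ i + B u \<omega> $ i)\<^sup>2 - (B s \<omega> $ i)\<^sup>2 - (B u \<omega> $ i)\<^sup>2) / 2)"
      using sq[of "{s}" "\<lambda>_. 1"] sq[of "{u}" "\<lambda>_. 1"] sq[of "{s,u}" "\<lambda>_. 1"] t False by simp
    then show ?thesis by (simp add: power2_eq_square algebra_simps)
  qed
qed

lemma fBm_increment_covariance:
  assumes B: "fBm M H T B" and t: "{a, b, c, e} \<subseteq> {0..T}"
  shows "(\<integral>\<omega>. (B b \<omega> $ i - B a \<omega> $ i) * (B e \<omega> $ i - B c \<omega> $ i) \<partial>M) =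
    (\<bar>e - a\<bar> powr (2 * H) + \<bar>c - b\<bar> powr (2 * H)
      - \<bar>e - b\<bar> powr (2 * H) - \<bar>c - a\<bar> powr (2 * H)) / 2"
proof -
  have int: "integrable M (\<lambda>\<omega>. B s \<omega> $ i * B u \<omega> $ i)" if "s \<in> {0..T}" "u \<in> {0..T}" for s u
    using fBm_value_product_integrable[OF B that] .
  have "(\<integral>\<omega>. (B b \<omega> $ i - B a \<omega> $ i) * (B e \<omega> $ i - B c \<omega> $ i) \<partial>M) =
    (\<integral>\<omega>. B b \<omega> $ i * B e \<omega> $ i - B b \<omega> $ i * B c \<omega> $ i - (B a \<omega> $ i * B e \<omega> $ i - B a \<omega> $ i * B c \<omega> $ i) \<partial>M)"
    by (rule Bochner_Integration.integral_cong) (auto simp: algebra_simps)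
  also have "\<dots> = (\<integral>\<omega>. B b \<omega> $ i * B e \<omega> $ i \<partial>M) - (\<integral>\<omega>. B b \<omega> $ i * B c \<omega> $ i \<partial>M)
     - ((\<integral>\<omega>. B a \<omega> $ i * B e \<omega> $ i \<partial>M) - (\<integral>\<omega>. B a \<omega> $ i * B c \<omega> $ i \<partial>M))"
    using t int by simp
  also have "\<dots> = (\<bar>e - a\<bar> powr (2 * H) + \<bar>c - b\<bar> powr (2 * H)
      - \<bar>e - b\<bar> powr (2 * H) - \<bar>c - a\<bar> powr (2 * H)) / 2"
    using t by (simp add: fBm_covariance[OF B] field_simps)
  finally show ?thesis .
qed

text \<open>Both factors apply the same functional of the path, \<open>x \<mapsto> (x\<^sub>b - x\<^sub>a) (x\<^sub>e - x\<^sub>c)\<close>, to two independent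
components.\<close>

lemma fBm_increment_products_independent:
  assumes B: "fBm M H T B" and t: "{a, b, c, e} \<subseteq> {0..T}" and ij: "i \<noteq> j"
  defines "P k \<omega> \<equiv> (B b \<omega> $ k - B a \<omega> $ k) * (B e \<omega> $ k - B c \<omega> $ k)"
  shows "integrable M (\<lambda>\<omega>. P i \<omega> * P j \<omega>)"
    and "(\<integral>\<omega>. P i \<omega> * P j \<omega> \<partial>M) = (\<integral>\<omega>. P i \<omega> \<partial>M) * (\<integral>\<omega>. P j \<omega> \<partial>M)"
proof -
  interpret prob_space M using B by (simp add: fBm_def)
  define f :: "(real \<Rightarrow> real) \<Rightarrow> real" where "f x = (x b - x a) * (x e - x c)" for x
  have f [measurable]: "f \<in> borel_measurable (\<Pi>\<^sub>M t\<in>{0..T}. borel)"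
    unfolding f_def using t
    by (intro borel_measurable_times borel_measurable_diff measurable_component_singleton) auto
  have "indep_vars (\<lambda>i. \<Pi>\<^sub>M t\<in>{0..T}. borel) (\<lambda>i \<omega>. \<lambda>t\<in>{0..T}. B t \<omega> $ i) UNIV"
    using B by (simp add: fBm_def)
  then have "indep_vars (\<lambda>i. \<Pi>\<^sub>M t\<in>{0..T}. borel) (\<lambda>i \<omega>. \<lambda>t\<in>{0..T}. B t \<omega> $ i) {i, j}"
    by (rule indep_vars_subset) simp
  then have "indep_vars (\<lambda>_. borel) (\<lambda>i \<omega>. f (\<lambda>t\<in>{0..T}. B t \<omega> $ i)) {i, j}"
    by (rule indep_vars_compose2) (rule f)
  moreover have "(\<lambda>i \<omega>. f (\<lambda>t\<in>{0..T}. B t \<omega> $ i)) = P"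
    using t by (auto simp: fun_eq_iff f_def P_def)
  ultimately have ind: "indep_vars (\<lambda>_. borel) P {i, j}" by simp
  have int: "integrable M (P k)" for k
    using fBm_increment_moments(1)[OF B t, of k] by (simp add: P_def[abs_def])
  show "integrable M (\<lambda>\<omega>. P i \<omega> * P j \<omega>)"
    using indep_vars_integrable[OF _ ind int] ij by simp
  show "(\<integral>\<omega>. P i \<omega> * P j \<omega> \<partial>M) = (\<integral>\<omega>. P i \<omega> \<partial>M) * (\<integral>\<omega>. P j \<omega> \<partial>M)"
    using indep_vars_lebesgue_integral[OF _ ind int] ij by simp
qed

section \<open>Quadratic variation along uniform grids\<close>

text \<open>Concavity of \<open>x \<mapsto> x powr q\<close>: both values lie below the tangent at \<open>m\<close>, which is Young's
inequality, and the slopes cancel. This is where the Hurst parameter being at most \<open>1/2\<close> enters.\<close>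

lemma powr_second_difference_nonpos:
  fixes m q :: real
  assumes "1 \<le> m" "0 < q" "q \<le> 1"
  shows "(m + 1) powr q + (m - 1) powr q \<le> 2 * m powr q"
proof -
  have tangent: "x powr q \<le> m powr q * (q * (x / m) + (1 - q))" if "x \<ge> 0" for x
  proof (cases "x = 0")
    case False
    then have "x powr q = m powr q * ((x / m) powr q * 1 powr (1 - q))"
      using assms that by (simp add: powr_divide)
    also have "\<dots> \<le> m powr q * (q * (x / m) + (1 - q) * 1)"
      using assms False that by (intro mult_left_mono Youngs_inequality_0) auto
    finally show ?thesis by simp
  qed (use assms in auto)
  have "(m + 1) powr q + (m - 1) powr q \<le>
      m powr q * (q * ((m + 1) / m) + (1 - q)) + m powr q * (q * ((m - 1) / m) + (1 - q))"
    using assms by (intro add_mono tangent) auto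
  also have "\<dots> = 2 * m powr q"
    using assms by (simp add: field_simps)
  finally show ?thesis .
qed

text \<open>The diagonal contributes \<open>n a\<close> to the total sum; since the total is nonnegative, the
off-diagonal entries, all of one sign, sum to at most \<open>n a\<close> in absolute value. With \<open>c\<^sup>2 \<le> a \<bar>c\<bar>\<close> this
bounds the squares, giving order \<open>n\<close> instead of the trivial \<open>n\<^sup>2\<close>.\<close>

lemma sum_squares_le_of_nonpos_off_diagonal:
  fixes c :: "nat \<Rightarrow> nat \<Rightarrow> real"
  assumes diag: "\<And>k. c k k = a"
    and off: "\<And>k l. k < n \<Longrightarrow> l < n \<Longrightarrow> k \<noteq> l \<Longrightarrow> c k l \<le> 0"
    and bound: "\<And>k l. k < n \<Longrightarrow> l < n \<Longrightarrow> \<bar>c k l\<bar> \<le> a"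
    and total: "0 \<le> (\<Sum>k<n. \<Sum>l<n. c k l)"
  shows "(\<Sum>k<n. \<Sum>l<n. (c k l)\<^sup>2) \<le> 2 * real n * a\<^sup>2"
proof (cases "n = 0")
  case False
  then have a: "a \<ge> 0" using bound[of 0 0] by simp
  have "(c k l)\<^sup>2 \<le> 2 * a\<^sup>2 * of_bool (l = k) - a * c k l" if "k < n" "l < n" for k l
  proof (cases "k = l")
    case True
    then show ?thesis using diag by (simp add: power2_eq_square)
  next
    case False
    have "(c k l)\<^sup>2 = \<bar>c k l\<bar> * \<bar>c k l\<bar>" by (simp add: power2_eq_square)
    also have "\<dots> \<le> a * \<bar>c k l\<bar>"
      using bound[OF that] by (rule mult_right_mono) simp
    finally show ?thesis using off[OF that False] False by simp
  qed
  then have "(\<Sum>k<n. \<Sum>l<n. (c k l)\<^sup>2) \<le> (\<Sum>k<n. \<Sum>l<n. 2 * a\<^sup>2 * of_bool (l = k) - a * c k l)"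
    by (intro sum_mono) auto
  also have "\<dots> = (\<Sum>k<n. 2 * a\<^sup>2 * (\<Sum>l<n. of_bool (l = k))) - a * (\<Sum>k<n. \<Sum>l<n. c k l)"
    by (simp add: sum_subtractf sum_distrib_left)
  also have "(\<Sum>k<n. 2 * a\<^sup>2 * (\<Sum>l<n. of_bool (l = k))) = 2 * real n * a\<^sup>2"
    by (simp add: of_bool_def)
  also have "2 * real n * a\<^sup>2 - a * (\<Sum>k<n. \<Sum>l<n. c k l) \<le> 2 * real n * a\<^sup>2"
    using a total by simp
  finally show ?thesis .
qed simp

definition grid_increment ::
  "real \<Rightarrow> nat \<Rightarrow> (real \<Rightarrow> 'a \<Rightarrow> real^'d) \<Rightarrow> 'd \<Rightarrow> nat \<Rightarrow> 'a \<Rightarrow> real" where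
  "grid_increment T n B i k \<omega> = B (real (Suc k) * T / n) \<omega> $ i - B (real k * T / n) \<omega> $ i"

definition grid_covariance :: "real \<Rightarrow> real \<Rightarrow> nat \<Rightarrow> nat \<Rightarrow> nat \<Rightarrow> real" where
  "grid_covariance H T n k l =
     (T / n) powr (2 * H) * (\<bar>real l - real k + 1\<bar> powr (2 * H) + \<bar>real l - real k - 1\<bar> powr (2 * H)
        - 2 * \<bar>real l - real k\<bar> powr (2 * H)) / 2"

lemma grid_points:
  assumes "0 < T" "k < n" "l < n"
  shows "{real k * T / n, real (Suc k) * T / n, real l * T / n, real (Suc l) * T / n} \<subseteq> {0..T}"
proof -
  have "real m * T / n \<in> {0..T}" if "m \<le> n" for m :: nat
    using that assms by (auto simp: divide_le_eq intro!: mult_right_mono)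
  then show ?thesis using assms(2,3) by (auto simp del: of_nat_Suc)
qed

lemma grid_increment_covariance:
  assumes B: "fBm M H T B" and T: "0 < T" and kl: "k < n" "l < n"
  shows "(\<integral>\<omega>. grid_increment T n B i k \<omega> * grid_increment T n B i l \<omega> \<partial>M) = grid_covariance H T n k l"
proof -
  have h: "0 < T / n" using T kl by simp
  have scale: "\<bar>x * T / n - y * T / n\<bar> powr (2 * H) = (T / n) powr (2 * H) * \<bar>x - y\<bar> powr (2 * H)" for x y
  proof -
    have "\<bar>x * T / n - y * T / n\<bar> = (T / n) * \<bar>x - y\<bar>"
      using T abs_mult[of "T / n" "x - y"] by (simp add: algebra_simps diff_divide_distrib)
    then show ?thesis using h by (simp only: powr_mult)
  qed
  show ?thesis
    unfolding grid_increment_def fBm_increment_covariance[OF B grid_points[OF T kl]] scale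
      grid_covariance_def
    by (simp add: algebra_simps abs_minus_commute)
qed

lemma grid_covariance_nonpos:
  assumes "k \<noteq> l" "0 < H" "H \<le> 1 / 2"
  shows "grid_covariance H T n k l \<le> 0"
proof -
  define m where "m = \<bar>real l - real k\<bar>"
  have m: "1 \<le> m" using assms(1) by (auto simp: m_def)
  have "\<bar>real l - real k + 1\<bar> powr (2 * H) + \<bar>real l - real k - 1\<bar> powr (2 * H)
      = (m + 1) powr (2 * H) + (m - 1) powr (2 * H)"
  proof (cases "k < l")
    case True
    then have "\<bar>real l - real k + 1\<bar> = m + 1" "\<bar>real l - real k - 1\<bar> = m - 1"
      by (auto simp: m_def)
    then show ?thesis by simp
  next
    case False
    then have "\<bar>real l - real k + 1\<bar> = m - 1" "\<bar>real l - real k - 1\<bar> = m + 1"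
      using assms(1) by (auto simp: m_def)
    then show ?thesis by simp
  qed
  also have "\<dots> \<le> 2 * m powr (2 * H)"
    using m assms by (intro powr_second_difference_nonpos) auto
  finally show ?thesis
    unfolding grid_covariance_def m_def[symmetric]
    by (simp add: mult_nonneg_nonpos)
qed

text \<open>The bounds on the entries and on their total are seen by reading them as moments: entries are at most
the variance of one increment, and the total is the second moment of the sum of all increments.\<close>

lemma sum_grid_covariance_squares_le:
  assumes B: "fBm M H T B" and T: "0 < T" and H: "0 < H" "H \<le> 1 / 2"
  shows "(\<Sum>k<n. \<Sum>l<n. (grid_covariance H T n k l)\<^sup>2) \<le> 2 * real n * ((T / n) powr (2 * H))\<^sup>2"
proof (rule sum_squares_le_of_nonpos_off_diagonal)
  \<comment> \<open>All components have the same covariance, so any index will do.\<close>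
  let ?a = "(T / n) powr (2 * H)" and ?U = "grid_increment T n B undefined"
  have int: "integrable M (\<lambda>\<omega>. ?U k \<omega> * ?U l \<omega>)" if "k < n" "l < n" for k l
    using fBm_increment_moments(1)[OF B grid_points[OF T that]] by (simp add: grid_increment_def)
  note cov = grid_increment_covariance[OF B T, of _ n _ undefined, symmetric]
  show diag: "grid_covariance H T n k k = ?a" for k
    by (simp add: grid_covariance_def)
  show "grid_covariance H T n k l \<le> 0" if "k < n" "l < n" "k \<noteq> l" for k l
    using grid_covariance_nonpos[OF that(3) H] .
  show "\<bar>grid_covariance H T n k l\<bar> \<le> ?a" if "k < n" "l < n" for k l
  proof -
    have "\<bar>grid_covariance H T n k l\<bar> \<le> (\<integral>\<omega>. \<bar>?U k \<omega> * ?U l \<omega>\<bar> \<partial>M)"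
      using cov[OF that] by (simp add: integral_abs_bound)
    also have "\<dots> \<le> (\<integral>\<omega>. (?U k \<omega> * ?U k \<omega> + ?U l \<omega> * ?U l \<omega>) / 2 \<partial>M)"
    proof (rule integral_mono)
      show "\<bar>?U k \<omega> * ?U l \<omega>\<bar> \<le> (?U k \<omega> * ?U k \<omega> + ?U l \<omega> * ?U l \<omega>) / 2" for \<omega>
        using zero_le_power2[of "\<bar>?U k \<omega>\<bar> - \<bar>?U l \<omega>\<bar>"]
        by (simp add: power2_eq_square algebra_simps abs_mult)
    qed (use int that in auto)
    also have "\<dots> = ?a"
      using int that cov[OF that(1) that(1)] cov[OF that(2) that(2)] by (simp add: diag)
    finally show ?thesis .
  qed
  have "(\<Sum>k<n. \<Sum>l<n. grid_covariance H T n k l) = (\<integral>\<omega>. (\<Sum>k<n. \<Sum>l<n. ?U k \<omega> * ?U l \<omega>) \<partial>M)"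
    using int by (subst Bochner_Integration.integral_sum, force)+ (simp add: cov)
  also have "\<dots> = (\<integral>\<omega>. (\<Sum>k<n. ?U k \<omega>)\<^sup>2 \<partial>M)"
    by (simp add: power2_eq_square sum_product)
  also have "\<dots> \<ge> 0" by simp
  finally show "0 \<le> (\<Sum>k<n. \<Sum>l<n. grid_covariance H T n k l)" .
qed

text \<open>Normalised so that the expected matrix is the identity.\<close>

definition grid_qv :: "real \<Rightarrow> real \<Rightarrow> nat \<Rightarrow> (real \<Rightarrow> 'a \<Rightarrow> real^'d) \<Rightarrow> 'd \<Rightarrow> 'd \<Rightarrow> 'a \<Rightarrow> real" where
  "grid_qv H T n B i j \<omega> =
     (\<Sum>k<n. grid_increment T n B i k \<omega> * grid_increment T n B j k \<omega>) / (n * (T / n) powr (2 * H))"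

text \<open>The second moment of the sum of \<open>n\<close> products is a double sum of fourth moments. In both cases the
excess over the squared mean is at most twice the sum of squared covariances: Isserlis' formula
gives it on the diagonal, independence of the components off the diagonal.\<close>

lemma grid_qv_L2:
  assumes B: "fBm M H T B" and T: "0 < T" and H: "0 < H" "H \<le> 1 / 2" and n: "0 < n"
  shows "integrable M (\<lambda>\<omega>. (grid_qv H T n B i j \<omega> - of_bool (i = j))\<^sup>2)"
    and "(\<integral>\<omega>. (grid_qv H T n B i j \<omega> - of_bool (i = j))\<^sup>2 \<partial>M) \<le> 4 / n"
proof -
  interpret prob_space M using B by (simp add: fBm_def)
  let ?U = "grid_increment T n B" and ?c = "grid_covariance H T n"
  define a where "a = (T / n) powr (2 * H)"
  define \<delta> :: real where "\<delta> = of_bool (i = j)"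
  have a: "0 < a" using T n by (simp add: a_def)
  have pair: "integrable M (\<lambda>\<omega>. (?U i k \<omega> * ?U j k \<omega>) * (?U i l \<omega> * ?U j l \<omega>)) \<and>
      (\<integral>\<omega>. (?U i k \<omega> * ?U j k \<omega>) * (?U i l \<omega> * ?U j l \<omega>) \<partial>M) \<le> \<delta> * a\<^sup>2 + 2 * (?c k l)\<^sup>2"
    if kl: "k < n" "l < n" for k l
  proof (cases "i = j")
    case True
    have eq: "(?U i k \<omega> * ?U j k \<omega>) * (?U i l \<omega> * ?U j l \<omega>) = (?U i k \<omega>)\<^sup>2 * (?U i l \<omega>)\<^sup>2" for \<omega>
      using True by (simp add: power2_eq_square)
    show ?thesis
      unfolding eq
      using fBm_increment_moments(2,3)[OF B grid_points[OF T kl], of i]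
        grid_increment_covariance[OF B T kl, of i] grid_increment_covariance[OF B T kl(1) kl(1), of i]
        grid_increment_covariance[OF B T kl(2) kl(2), of i] True
      unfolding grid_increment_def[symmetric]
      by (simp add: \<delta>_def power2_eq_square) (simp add: grid_covariance_def a_def)
  next
    case False
    have eq: "(?U i k \<omega> * ?U j k \<omega>) * (?U i l \<omega> * ?U j l \<omega>) = (?U i k \<omega> * ?U i l \<omega>) * (?U j k \<omega> * ?U j l \<omega>)" for \<omega>
      by (simp add: ac_simps)
    show ?thesis
      unfolding eq
      using fBm_increment_products_independent[OF B grid_points[OF T kl] False]
        grid_increment_covariance[OF B T kl]
      unfolding grid_increment_def[symmetric]
      by (simp add: \<delta>_def power2_eq_square False)
  qed
  define X where "X \<omega> = (\<Sum>k<n. ?U i k \<omega> * ?U j k \<omega>)" for \<omega>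
  have X2: "(X \<omega>)\<^sup>2 = (\<Sum>k<n. \<Sum>l<n. (?U i k \<omega> * ?U j k \<omega>) * (?U i l \<omega> * ?U j l \<omega>))" for \<omega>
    by (simp add: X_def power2_eq_square sum_product)
  have iX2: "integrable M (\<lambda>\<omega>. (X \<omega>)\<^sup>2)"
    unfolding X2 using pair by (intro Bochner_Integration.integrable_sum) auto
  have "(\<integral>\<omega>. (X \<omega>)\<^sup>2 \<partial>M) =
      (\<Sum>k<n. \<Sum>l<n. \<integral>\<omega>. (?U i k \<omega> * ?U j k \<omega>) * (?U i l \<omega> * ?U j l \<omega>) \<partial>M)"
    unfolding X2 using pair
    by (subst Bochner_Integration.integral_sum, force)+ simp
  also have "\<dots> \<le> (\<Sum>k<n. \<Sum>l<n. \<delta> * a\<^sup>2 + 2 * (?c k l)\<^sup>2)"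
    using pair by (intro sum_mono) auto
  also have "\<dots> = \<delta> * (n * a)\<^sup>2 + 2 * (\<Sum>k<n. \<Sum>l<n. (?c k l)\<^sup>2)"
    by (simp add: sum.distrib sum_distrib_left power2_eq_square algebra_simps)
  also have "\<dots> \<le> \<delta> * (n * a)\<^sup>2 + 4 * real n * a\<^sup>2"
    using sum_grid_covariance_squares_le[OF B T H, of n] by (simp add: a_def)
  finally have EX2: "(\<integral>\<omega>. (X \<omega>)\<^sup>2 \<partial>M) \<le> \<delta> * (n * a)\<^sup>2 + 4 * real n * a\<^sup>2" .
  have EX: "integrable M (\<lambda>\<omega>. \<delta> * X \<omega>) \<and> (\<integral>\<omega>. \<delta> * X \<omega> \<partial>M) = \<delta> * (n * a)"
  proof (cases "i = j")
    case True
    have "integrable M (\<lambda>\<omega>. ?U i k \<omega> * ?U i k \<omega>)" "(\<integral>\<omega>. ?U i k \<omega> * ?U i k \<omega> \<partial>M) = a" if "k < n" for k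
      using fBm_increment_moments(1)[OF B grid_points[OF T that that], of i]
        grid_increment_covariance[OF B T that that, of i]
      unfolding grid_increment_def[symmetric] by (auto simp: grid_covariance_def a_def)
    then have "integrable M X" "(\<integral>\<omega>. X \<omega> \<partial>M) = n * a"
      unfolding X_def[abs_def] using True
      by (auto intro!: Bochner_Integration.integrable_sum simp: Bochner_Integration.integral_sum)
    then show ?thesis using True by (simp add: \<delta>_def)
  qed (simp add: \<delta>_def)
  have sq: "(grid_qv H T n B i j \<omega> - of_bool (i = j))\<^sup>2 =
      ((X \<omega>)\<^sup>2 - 2 * (n * a) * (\<delta> * X \<omega>) + \<delta> * (n * a)\<^sup>2) / (n * a)\<^sup>2" for \<omega>
    unfolding grid_qv_def X_def[symmetric] a_def[symmetric] using a n
    by (cases "i = j") (simp_all add: \<delta>_def field_simps power2_eq_square)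
  show "integrable M (\<lambda>\<omega>. (grid_qv H T n B i j \<omega> - of_bool (i = j))\<^sup>2)"
    unfolding sq using iX2 EX by simp
  have "(\<integral>\<omega>. (grid_qv H T n B i j \<omega> - of_bool (i = j))\<^sup>2 \<partial>M) =
      ((\<integral>\<omega>. (X \<omega>)\<^sup>2 \<partial>M) - 2 * (n * a) * (\<integral>\<omega>. \<delta> * X \<omega> \<partial>M) + \<delta> * (n * a)\<^sup>2) / (n * a)\<^sup>2"
    unfolding sq using iX2 EX by (simp add: prob_space)
  also have "\<dots> = ((\<integral>\<omega>. (X \<omega>)\<^sup>2 \<partial>M) - \<delta> * (n * a)\<^sup>2) / (n * a)\<^sup>2"
    unfolding EX[THEN conjunct2] by (simp add: power2_eq_square algebra_simps)
  also have "\<dots> \<le> (4 * real n * a\<^sup>2) / (n * a)\<^sup>2"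
    using EX2 by (intro divide_right_mono) auto
  also have "\<dots> = 4 / n" using a n by (simp add: power2_eq_square)
  finally show "(\<integral>\<omega>. (grid_qv H T n B i j \<omega> - of_bool (i = j))\<^sup>2 \<partial>M) \<le> 4 / n" .
qed

text \<open>A single subsequence has to serve all entries, so that limits of quadratic forms can be taken for
all directions at once; hence the entries are combined before the subsequence is chosen.\<close>

lemma AE_grid_qv_subsequence:
  assumes B: "fBm M H T (B :: real \<Rightarrow> 'a \<Rightarrow> real^'d)" and T: "0 < T" and H: "0 < H" "H \<le> 1 / 2"
  shows "\<exists>r::nat \<Rightarrow> nat. strict_mono r \<and>
    (AE \<omega> in M. \<forall>i j. (\<lambda>m. grid_qv H T (Suc (r m)) B i j \<omega>) \<longlonglongrightarrow> of_bool (i = j))"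
proof -
  define u where
    "u m \<omega> = (\<Sum>i\<in>UNIV. \<Sum>j\<in>UNIV. (grid_qv H T (Suc m) B i j \<omega> - of_bool (i = j))\<^sup>2)" for m \<omega>
  note L2 = grid_qv_L2[OF B T H zero_less_Suc]
  have u_nonneg: "0 \<le> u m \<omega>" for m \<omega>
    by (simp add: u_def sum_nonneg)
  have int: "integrable M (u m)" for m
    unfolding u_def using L2(1) by simp
  have "(\<integral>\<omega>. norm (u m \<omega>) \<partial>M) =
      (\<Sum>i\<in>UNIV. \<Sum>j\<in>UNIV. \<integral>\<omega>. (grid_qv H T (Suc m) B i j \<omega> - of_bool (i = j))\<^sup>2 \<partial>M)" for m
    unfolding real_norm_def abs_of_nonneg[OF u_nonneg] unfolding u_def using L2(1) by simp
  also have "\<dots> m \<le> (\<Sum>i\<in>(UNIV::'d set). \<Sum>j\<in>(UNIV::'d set). 4 / Suc m)" for m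
    by (intro sum_mono L2(2))
  finally have le: "(\<integral>\<omega>. norm (u m \<omega>) \<partial>M) \<le> real CARD('d) * real CARD('d) * 4 / Suc m" for m
    by (simp add: ac_simps)
  have "(\<lambda>m. \<integral>\<omega>. norm (u m \<omega>) \<partial>M) \<longlonglongrightarrow> 0"
  proof (rule tendsto_sandwich[OF _ _ tendsto_const])
    have "(\<lambda>m. real CARD('d) * real CARD('d) * 4 * inverse (Suc m)) \<longlonglongrightarrow> real CARD('d) * real CARD('d) * 4 * 0"
      by (intro tendsto_intros LIMSEQ_inverse_real_of_nat)
    then show "(\<lambda>m. real CARD('d) * real CARD('d) * 4 / Suc m) \<longlonglongrightarrow> 0"
      by (simp add: divide_inverse)
  qed (use le in \<open>auto intro!: always_eventually\<close>)
  from tendsto_L1_AE_subseq[OF int this] obtain r :: "nat \<Rightarrow> nat"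
    where r: "strict_mono r" "AE \<omega> in M. (\<lambda>m. u (r m) \<omega>) \<longlonglongrightarrow> 0" by blast
  have conv: "(\<lambda>m. grid_qv H T (Suc (r m)) B i j \<omega>) \<longlonglongrightarrow> of_bool (i = j)"
    if lim: "(\<lambda>m. u (r m) \<omega>) \<longlonglongrightarrow> 0" for \<omega> i j
  proof -
    let ?x = "\<lambda>m. grid_qv H T (Suc (r m)) B i j \<omega> - of_bool (i = j)"
    have "(?x m)\<^sup>2 \<le> u (r m) \<omega>" for m
    proof -
      have "(?x m)\<^sup>2 \<le> (\<Sum>j'\<in>UNIV. (grid_qv H T (Suc (r m)) B i j' \<omega> - of_bool (i = j'))\<^sup>2)"
        by (rule member_le_sum) auto
      also have "\<dots> \<le> u (r m) \<omega>"
        unfolding u_def by (rule member_le_sum) (auto intro: sum_nonneg)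
      finally show ?thesis .
    qed
    then have "(\<lambda>m. (?x m)\<^sup>2) \<longlonglongrightarrow> 0"
      by (intro tendsto_sandwich[OF _ _ tendsto_const lim]) auto
    then have "?x \<longlonglongrightarrow> 0" by (simp add: tendsto_null_power)
    then show ?thesis by (rule LIM_zero_cancel)
  qed
  have "AE \<omega> in M. \<forall>i j. (\<lambda>m. grid_qv H T (Suc (r m)) B i j \<omega>) \<longlonglongrightarrow> of_bool (i = j)"
    using r(2) by eventually_elim (intro allI conv)
  with r(1) show ?thesis by blast
qed

text \<open>For a Lipschitz projection the rescaled quadratic variation is at most \<open>C\<^sup>2 h\<^bsup>2 - 2H\<^esup>\<close> on the grid of step \<open>h\<close> and
tends to \<open>0\<close>; along the subsequence it also tends to \<open>w \<bullet> w\<close>. The quantifier over \<open>w\<close> stands inside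
the almost sure event.\<close>

lemma fBm_no_lipschitz_projection:
  assumes B: "fBm M H T (B :: real \<Rightarrow> 'a \<Rightarrow> real^'d)" and T: "0 < T" and H: "0 < H" "H \<le> 1 / 2"
  shows "AE \<omega> in M. \<forall>w C. (\<forall>s t. 0 \<le> s \<and> s \<le> t \<and> t \<le> T \<longrightarrow>
      \<bar>w \<bullet> (B t \<omega> - B s \<omega>)\<bar> \<le> C * (t - s)) \<longrightarrow> w = 0"
proof -
  obtain r :: "nat \<Rightarrow> nat" where r: "strict_mono r"
    and ae: "AE \<omega> in M. \<forall>i j. (\<lambda>m. grid_qv H T (Suc (r m)) B i j \<omega>) \<longlonglongrightarrow> of_bool (i = j)"
    using AE_grid_qv_subsequence[OF B T H] by blast
  define h where "h m = T / Suc (r m)" for m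
  have h0: "0 < h m" for m using T by (simp add: h_def)
  have "(\<lambda>m. T * inverse (Suc (r m))) \<longlonglongrightarrow> T * 0"
    using LIMSEQ_subseq_LIMSEQ[OF LIMSEQ_inverse_real_of_nat r]
    by (intro tendsto_intros) (simp add: o_def)
  then have h: "h \<longlonglongrightarrow> 0" by (simp add: h_def[abs_def] divide_inverse)
  have zero: "w = 0" if qv: "\<forall>i j. (\<lambda>m. grid_qv H T (Suc (r m)) B i j \<omega>) \<longlonglongrightarrow> of_bool (i = j)"
    and lip: "\<forall>s t. 0 \<le> s \<and> s \<le> t \<and> t \<le> T \<longrightarrow> \<bar>w \<bullet> (B t \<omega> - B s \<omega>)\<bar> \<le> C * (t - s)" for \<omega> w C
  proof -
    define q where "q m = (\<Sum>i\<in>UNIV. \<Sum>j\<in>UNIV. w $ i * w $ j * grid_qv H T (Suc (r m)) B i j \<omega>)" for m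
    have "q \<longlonglongrightarrow> (\<Sum>i\<in>UNIV. \<Sum>j\<in>UNIV. w $ i * w $ j * of_bool (i = j))"
      unfolding q_def using qv by (intro tendsto_intros) auto
    also have "(\<Sum>i\<in>UNIV. \<Sum>j\<in>UNIV. w $ i * w $ j * of_bool (i = j)) = w \<bullet> w"
      by (simp add: inner_vec_def of_bool_def if_distrib cong: if_cong)
    finally have q: "q \<longlonglongrightarrow> w \<bullet> w" .
    have q_eq: "q m = (\<Sum>k<Suc (r m). (w \<bullet> (B (real (Suc k) * T / Suc (r m)) \<omega> - B (real k * T / Suc (r m)) \<omega>))\<^sup>2)
        / (Suc (r m) * h m powr (2 * H))" for m
    proof -
      let ?n = "Suc (r m)"
      let ?U = "grid_increment T ?n B"
      have w: "w \<bullet> (B (real (Suc k) * T / ?n) \<omega> - B (real k * T / ?n) \<omega>) = (\<Sum>i\<in>UNIV. w $ i * ?U i k \<omega>)" for k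
        by (simp add: inner_vec_def grid_increment_def)
      have "(\<Sum>i\<in>UNIV. \<Sum>j\<in>UNIV. w $ i * w $ j * (\<Sum>k<?n. ?U i k \<omega> * ?U j k \<omega>)) =
          (\<Sum>i\<in>UNIV. \<Sum>k<?n. \<Sum>j\<in>UNIV. (w $ i * ?U i k \<omega>) * (w $ j * ?U j k \<omega>))"
        unfolding sum_distrib_left
        by (rule sum.cong[OF refl], subst sum.swap) (simp add: ac_simps)
      also have "\<dots> = (\<Sum>k<?n. (\<Sum>i\<in>UNIV. w $ i * ?U i k \<omega>)\<^sup>2)"
        by (subst sum.swap) (simp only: power2_eq_square sum_product)
      finally show ?thesis
        unfolding w q_def grid_qv_def h_def
        by (simp only: times_divide_eq_right sum_divide_distrib[symmetric])
    qed
    have upper: "q m \<le> C\<^sup>2 * h m powr (2 - 2 * H)" for m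
    proof -
      let ?n = "Suc (r m)"
      have "(w \<bullet> (B (real (Suc k) * T / ?n) \<omega> - B (real k * T / ?n) \<omega>))\<^sup>2 \<le> (C * h m)\<^sup>2" if "k < ?n" for k
      proof -
        have "real (Suc k) * T / ?n - real k * T / ?n = h m"
          by (simp add: h_def diff_divide_distrib[symmetric] distrib_right)
        then have "\<bar>w \<bullet> (B (real (Suc k) * T / ?n) \<omega> - B (real k * T / ?n) \<omega>)\<bar> \<le> C * h m"
          using lip[rule_format, of "real k * T / ?n" "real (Suc k) * T / ?n"] grid_points[OF T that that] h0[of m]
          by (simp del: of_nat_Suc)
        then show ?thesis by (metis abs_ge_zero power2_abs power_mono)
      qed
      then have "q m \<le> (\<Sum>k<?n. (C * h m)\<^sup>2) / (?n * h m powr (2 * H))"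
        unfolding q_eq by (intro divide_right_mono sum_mono) auto
      also have "\<dots> = C\<^sup>2 * ((h m)\<^sup>2 / h m powr (2 * H))"
        by (simp add: power_mult_distrib del: of_nat_Suc)
      also have "(h m)\<^sup>2 / h m powr (2 * H) = h m powr (2 - 2 * H)"
        using h0[of m] by (simp add: powr_diff powr_realpow)
      finally show ?thesis .
    qed
    have "(\<lambda>m. h m powr (2 - 2 * H)) \<longlonglongrightarrow> 0"
      using H h h0 by (intro tendsto_zero_powrI[OF h tendsto_const]) (auto simp: less_imp_le)
    then have "(\<lambda>m. C\<^sup>2 * h m powr (2 - 2 * H)) \<longlonglongrightarrow> C\<^sup>2 * 0"
      by (intro tendsto_intros)
    then have "w \<bullet> w \<le> C\<^sup>2 * 0"
      using LIMSEQ_le[OF q, of "\<lambda>m. C\<^sup>2 * h m powr (2 - 2 * H)"] upper by auto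
    then show "w = 0" by (metis inner_gt_zero_iff mult_zero_right not_less)
  qed
  show ?thesis
    using ae by eventually_elim (use zero in blast)
qed

section \<open>Partitions and the variation distance\<close>

lemma eventually_mesh_to_0:
  "eventually P (mesh_to_0 u v) \<longleftrightarrow>
    (\<exists>\<delta>>0. \<forall>n t. (n, t) \<in> partitions u v \<and> (\<forall>i<n. t (Suc i) - t i < \<delta>) \<longrightarrow> P (n, t))"
  unfolding mesh_to_0_def
proof (subst eventually_INF_base)
  fix a b :: real
  assume "a \<in> {0<..}" "b \<in> {0<..}"
  then show "\<exists>x\<in>{0<..}. principal {(n, t). (n, t) \<in> partitions u v \<and> (\<forall>i<n. t (Suc i) - t i < x)}
      \<le> principal {(n, t). (n, t) \<in> partitions u v \<and> (\<forall>i<n. t (Suc i) - t i < a)}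
        \<sqinter> principal {(n, t). (n, t) \<in> partitions u v \<and> (\<forall>i<n. t (Suc i) - t i < b)}"
    by (intro bexI[of _ "min a b"]) auto
qed (auto simp: eventually_principal)

text \<open>Uniform partitions have arbitrarily small mesh. This makes limits along the filter, and thus
the value of a rough integral, unique.\<close>

lemma mesh_to_0_nontrivial:
  assumes "u < v"
  shows "mesh_to_0 u v \<noteq> bot"
proof
  assume "mesh_to_0 u v = bot"
  then have "eventually (\<lambda>_. False) (mesh_to_0 u v)" by simp
  then obtain \<delta> where \<delta>: "\<delta> > 0"
    and none: "\<And>n t. (n, t) \<in> partitions u v \<Longrightarrow> (\<forall>i<n. t (Suc i) - t i < \<delta>) \<Longrightarrow> False"
    unfolding eventually_mesh_to_0 by blast
  obtain n :: nat where n: "(v - u) / \<delta> < n" using reals_Archimedean2 by blast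
  then have n0: "0 < n" using assms \<delta> by (cases n) (auto simp: field_simps)
  define t where "t i = u + real i * ((v - u) / n)" for i
  have step: "t (Suc i) - t i = (v - u) / n" for i
    by (simp add: t_def distrib_right del: times_divide_eq_right)
  have "0 < (v - u) / n" using assms n0 by simp
  then have "t i < t (Suc i)" for i using step[of i] by linarith
  then have "(n, t) \<in> partitions u v"
    using n0 by (simp add: partitions_def) (simp add: t_def)
  moreover have "(v - u) / n < \<delta>" using n \<delta> n0 by (simp add: field_simps)
  ultimately show False using none[of n t] by (simp add: step)
qed

lemma partition_points:
  assumes "(n, t) \<in> partitions u v" "i \<le> n"
  shows "u \<le> t i" "t i \<le> v"
proof -
  have step: "t j \<le> t (Suc j)" if "j < n" for j
    using assms that by (auto simp: partitions_def less_imp_le)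
  have mono: "t j \<le> t (j + d)" if "j + d \<le> n" for j d
    using that by (induction d) (auto intro: order_trans[OF _ step])
  show "u \<le> t i" "t i \<le> v"
    using mono[of 0 i] mono[of i "n - i"] assms by (auto simp: partitions_def)
qed

lemma partition_increment_le_pvar:
  assumes "(n, t) \<in> partitions 0 T" "i < n" "0 < q"
  shows "ennreal (norm (A (t i) (t (Suc i)))) \<le> pvar q T A"
proof -
  have "norm (A (t i) (t (Suc i))) powr q \<le> (\<Sum>j<n. norm (A (t j) (t (Suc j))) powr q)"
    using assms by (intro member_le_sum) auto
  then have "(norm (A (t i) (t (Suc i))) powr q) powr (1 / q)
      \<le> (\<Sum>j<n. norm (A (t j) (t (Suc j))) powr q) powr (1 / q)"
    using assms by (intro powr_mono2) auto
  then have "norm (A (t i) (t (Suc i))) \<le> psum (\<lambda>s t. norm (A s t) powr q) (n, t) powr (1 / q)"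
    using assms by (simp add: powr_powr psum_def)
  then have "ennreal (norm (A (t i) (t (Suc i))))
      \<le> ennreal (psum (\<lambda>s t. norm (A s t) powr q) (n, t) powr (1 / q))"
    by (rule ennreal_leI)
  also have "\<dots> \<le> pvar q T A"
    unfolding pvar_def by (rule SUP_upper) (rule assms)
  finally show ?thesis .
qed

lemma increment_from_0_le_pvar:
  assumes "0 < s" "s \<le> T" "0 < q"
  shows "ennreal (norm (A 0 s)) \<le> pvar q T A"
proof (cases "s = T")
  case True
  have "(Suc 0, \<lambda>i. if i = 0 then 0 else T) \<in> partitions 0 T"
    using assms True by (auto simp: partitions_def)
  from partition_increment_le_pvar[OF this, of 0 q A] show ?thesis using assms True by simp
next
  case False
  have "(2, \<lambda>i. if i = 0 then 0 else if i = 1 then s else T) \<in> partitions 0 T"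
    using assms False by (auto simp: partitions_def numeral_2_eq_2 less_Suc_eq)
  from partition_increment_le_pvar[OF this, of 0 q A] show ?thesis using assms False by simp
qed

lemma dp_less_imp_increments_close:
  assumes d: "dp p T X Y < ennreal \<delta>" and s: "0 < s" "s \<le> T" and p: "0 < p"
  shows "norm (fst (X 0 s) - fst (Y 0 s)) < \<delta>" "norm (snd (X 0 s) - snd (Y 0 s)) < \<delta>"
proof -
  have "ennreal (norm (fst (X 0 s) - fst (Y 0 s))) < ennreal \<delta>"
    using increment_from_0_le_pvar[OF s p, of "\<lambda>s t. fst (X s t) - fst (Y s t)"] d
    by (auto simp: dp_def)
  then show "norm (fst (X 0 s) - fst (Y 0 s)) < \<delta>"
    by (simp add: ennreal_less_iff)
  have "ennreal (norm (snd (X 0 s) - snd (Y 0 s))) < ennreal \<delta>"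
    using increment_from_0_le_pvar[OF s, of "p / 2" "\<lambda>s t. snd (X s t) - snd (Y s t)"] d p
    by (auto simp: dp_def)
  then show "norm (snd (X 0 s) - snd (Y 0 s)) < \<delta>"
    by (simp add: ennreal_less_iff)
qed

lemma path_from_close:
  assumes d: "dp p T X Y < ennreal \<delta>" and s: "s \<in> {0..T}" and p: "0 < p" and \<delta>: "0 < \<delta>"
  shows "norm (path_from y0 Y s - path_from y0 X s) < \<delta>"
proof (cases "s = 0")
  case True
  then show ?thesis using \<delta> by (simp add: path_from_def lev1_def)
next
  case False
  then have s': "0 < s" "s \<le> T" using s by auto
  then have "path_from y0 Y s - path_from y0 X s = fst (Y 0 s) - fst (X 0 s)"
    by (simp add: path_from_def lev1_def)
  then show ?thesis
    using dp_less_imp_increments_close(1)[OF d s' p] by (simp add: norm_minus_commute)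
qed

lemma path_from_continuous:
  assumes "Y \<in> rough_paths p T"
  shows "continuous_on {0..T} (path_from y0 Y)"
proof -
  obtain y where y: "continuous_on {0..T} y"
    "\<forall>s t. 0 \<le> s \<and> s < t \<and> t \<le> T \<longrightarrow> fst (Y s t) = y t - y s"
    using assms by (auto simp: rough_paths_def)
  have "path_from y0 Y s = y0 + (y s - y 0)" if "s \<in> {0..T}" for s
    using that y(2) by (auto simp: path_from_def lev1_def)
  then show ?thesis
    by (subst continuous_on_cong[OF refl]) (auto intro!: continuous_intros y(1))
qed

section \<open>Rough integrals of linear one-forms\<close>

lemma linear_DF_contract: "linear (DF_contract F y)"
  by (rule linearI)
     (auto simp: DF_contract_def algebra_simps sum.distrib scaleR_sum_right)

lemma DF_contract_tensor:
  assumes F: "bounded_linear F"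
  shows "DF_contract F y (tensor x z) = blinfun_apply (F x) z"
proof -
  have "frechet_derivative F (at y) = F"
    using frechet_derivative_at[OF bounded_linear_imp_has_derivative[OF F]] by simp
  then have contract: "DF_contract F y (tensor x z) =
      (\<Sum>i\<in>UNIV. \<Sum>j\<in>UNIV. (x $ i * z $ j) *\<^sub>R blinfun_apply (F (axis i 1)) (axis j 1))"
    by (simp add: DF_contract_def tensor_def)
  have Fx: "F x = (\<Sum>i\<in>UNIV. x $ i *\<^sub>R F (axis i 1))"
  proof -
    have "F x = F (\<Sum>i\<in>UNIV. x $ i *\<^sub>R axis i 1)"
      by (simp add: basis_expansion scalar_mult_eq_scaleR[symmetric])
    then show ?thesis
      by (simp add: linear_sum[OF bounded_linear.linear[OF F]] linear_cmul[OF bounded_linear.linear[OF F]])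
  qed
  have z: "blinfun_apply G z = (\<Sum>j\<in>UNIV. z $ j *\<^sub>R blinfun_apply G (axis j 1))" for G
  proof -
    have "blinfun_apply G z = blinfun_apply G (\<Sum>j\<in>UNIV. z $ j *\<^sub>R axis j 1)"
      by (simp add: basis_expansion scalar_mult_eq_scaleR[symmetric])
    then show ?thesis by (simp add: blinfun.sum_right blinfun.scaleR_right)
  qed
  have "blinfun_apply (F x) z = (\<Sum>i\<in>UNIV. x $ i *\<^sub>R blinfun_apply (F (axis i 1)) z)"
    by (subst Fx) (simp add: blinfun.sum_left blinfun.scaleR_left)
  also have "\<dots> = DF_contract F y (tensor x z)"
    unfolding contract by (simp only: z scaleR_sum_right scaleR_scaleR)
  finally show ?thesis by simp
qed

lemma DF_contract_const:
  assumes F: "bounded_linear F"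
  shows "DF_contract F y = DF_contract F y'"
proof -
  have "frechet_derivative F (at y) = F" for y
    using frechet_derivative_at[OF bounded_linear_imp_has_derivative[OF F]] by simp
  then show ?thesis by (simp add: DF_contract_def fun_eq_iff)
qed

lemma tensor_add_left: "tensor (x + y) z = tensor x z + tensor y z"
  and tensor_add_right: "tensor x (y + z) = tensor x y + tensor x z"
  and tensor_0_right: "tensor x 0 = 0"
  by (simp_all add: tensor_def vec_eq_iff algebra_simps)

text \<open>With \<open>A\<^sub>s = y\<^sub>0 \<otimes> Y\<^sub>0\<^sub>s + YY\<^sub>0\<^sub>s\<close>, linearity of \<open>F\<close> makes each summand the image under a fixed linear map of
\<open>(y\<^sub>0 + Y\<^sub>0\<^sub>s) \<otimes> Y\<^sub>s\<^sub>t + YY\<^sub>s\<^sub>t\<close>, which is \<open>A\<^sub>t - A\<^sub>s\<close> by Chen's identity. The sums therefore telescope.\<close>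

lemma rough_integral_bounded_linear:
  assumes Y: "Y \<in> rough_paths p T" and T: "0 < T" and F: "bounded_linear F"
  shows "has_rough_integral1 F y0 Y 0 T (DF_contract F 0 (tensor y0 (fst (Y 0 T)) + snd (Y 0 T)))"
    and "rough_integral1 F y0 Y 0 T = DF_contract F 0 (tensor y0 (fst (Y 0 T)) + snd (Y 0 T))"
proof -
  let ?D = "DF_contract F 0"
  let ?I = "?D (tensor y0 (fst (Y 0 T)) + snd (Y 0 T))"
  obtain y where y: "\<And>s t. 0 \<le> s \<Longrightarrow> s < t \<Longrightarrow> t \<le> T \<Longrightarrow> fst (Y s t) = y t - y s"
    using Y by (auto simp: rough_paths_def)
  have chen: "snd (Y s t) - snd (Y s u) - snd (Y u t) = tensor (fst (Y s u)) (fst (Y u t))"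
    if "0 \<le> s" "s < u" "u < t" "t \<le> T" for s u t
    using Y that by (auto simp: rough_paths_def)
  \<comment> \<open>The second level over a degenerate interval is arbitrary and is replaced by zero.\<close>
  define A where "A s = tensor y0 (lev1 Y 0 s) + (if 0 < s then snd (Y 0 s) else 0)" for s
  have incr: "tensor (path_from y0 Y s) (fst (Y s t)) + snd (Y s t) = A t - A s"
    if st: "0 \<le> s" "s < t" "t \<le> T" for s t
  proof (cases "s = 0")
    case True
    then show ?thesis using st by (simp add: A_def path_from_def lev1_def tensor_0_right)
  next
    case False
    have "fst (Y 0 t) = fst (Y 0 s) + fst (Y s t)" using st False by (simp add: y)
    then show ?thesis
      using st False chen[of 0 s t]
      by (simp add: A_def path_from_def lev1_def tensor_add_left tensor_add_right algebra_simps)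
  qed
  have sum: "psum (\<lambda>s t. blinfun_apply (F (path_from y0 Y s)) (fst (Y s t))
      + DF_contract F (path_from y0 Y s) (snd (Y s t))) (n, t) = ?I"
    if P: "(n, t) \<in> partitions 0 T" for n t
  proof -
    have ends: "t 0 = 0" "t n = T" and inc: "\<And>i. i < n \<Longrightarrow> t i < t (Suc i)"
      using P by (auto simp: partitions_def)
    have "psum (\<lambda>s t. blinfun_apply (F (path_from y0 Y s)) (fst (Y s t))
        + DF_contract F (path_from y0 Y s) (snd (Y s t))) (n, t) = (\<Sum>i<n. ?D (A (t (Suc i))) - ?D (A (t i)))"
      unfolding psum_def
    proof (rule sum.cong, simp_all)
      fix i assume i: "i < n"
      have "blinfun_apply (F (path_from y0 Y (t i))) (fst (Y (t i) (t (Suc i))))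
          + DF_contract F (path_from y0 Y (t i)) (snd (Y (t i) (t (Suc i))))
        = ?D (tensor (path_from y0 Y (t i)) (fst (Y (t i) (t (Suc i)))) + snd (Y (t i) (t (Suc i))))"
        using DF_contract_const[OF F, of "path_from y0 Y (t i)" 0] DF_contract_tensor[OF F]
        by (simp add: linear_add[OF linear_DF_contract])
      also have "\<dots> = ?D (A (t (Suc i)) - A (t i))"
        using i inc partition_points[OF P] by (subst incr) auto
      finally show "blinfun_apply (F (path_from y0 Y (t i))) (fst (Y (t i) (t (Suc i))))
          + DF_contract F (path_from y0 Y (t i)) (snd (Y (t i) (t (Suc i))))
        = ?D (A (t (Suc i))) - ?D (A (t i))"
        by (simp add: linear_diff[OF linear_DF_contract])
    qed
    also have "\<dots> = ?D (A T) - ?D (A 0)"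
      by (simp add: sum_lessThan_telescope[of "\<lambda>i. ?D (A (t i))"] ends)
    also have "\<dots> = ?I"
      using T by (simp add: A_def lev1_def tensor_0_right linear_0[OF linear_DF_contract])
    finally show ?thesis .
  qed
  show I: "has_rough_integral1 F y0 Y 0 T ?I"
    unfolding has_rough_integral1_def
    by (rule tendsto_eventually, unfold eventually_mesh_to_0) (use sum zero_less_one in blast)
  show "rough_integral1 F y0 Y 0 T = ?I"
    unfolding rough_integral1_def
  proof (rule the_equality)
    show "has_rough_integral1 F y0 Y 0 T ?I" by (rule I)
  next
    fix J assume "has_rough_integral1 F y0 Y 0 T J"
    then show "J = ?I"
      using I tendsto_unique[OF mesh_to_0_nontrivial[OF T]]
      unfolding has_rough_integral1_def by blast
  qed
qed

section \<open>Continuity of the estimator\<close>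

lemma S_form_apply:
  "blinfun_apply (blinfun_apply (S_form Q x) \<xi>) G = (G *v x) \<bullet> (matrix_inv Q *v \<xi>)"
  by (simp add: S_form_def blinfun_transp.rep_eq I_tensor.rep_eq mat_blinfun.rep_eq
      blinfun_compose.rep_eq)

lemma bounded_linear_S_form: "bounded_linear (S_form Q :: real^'a::finite \<Rightarrow> _)"
proof (rule linear_conv_bounded_linear[THEN iffD1], rule linearI)
  fix x y :: "real^'a" and r :: real
  show "S_form Q (x + y) = S_form Q x + S_form Q y"
    by (rule blinfun_eqI, rule blinfun_eqI)
       (simp add: S_form_apply blinfun.add_left matrix_vector_right_distrib inner_add_left)
  show "S_form Q (r *\<^sub>R x) = r *\<^sub>R S_form Q x"
    by (rule blinfun_eqI, rule blinfun_eqI)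
       (simp add: S_form_apply blinfun.scaleR_left matrix_vector_mult_scaleR)
qed

lemma bounded_linear_I_tensor: "bounded_linear (I_tensor :: real^'d \<Rightarrow> _)"
proof (rule linear_conv_bounded_linear[THEN iffD1], rule linearI)
  fix x y :: "real^'d" and r :: real
  show "I_tensor (x + y) = I_tensor x + I_tensor y"
    by (rule blinfun_eqI) (simp add: I_tensor.rep_eq blinfun.add_left matrix_vector_right_distrib)
  show "I_tensor (r *\<^sub>R x) = r *\<^sub>R I_tensor x"
    by (rule blinfun_eqI) (simp add: I_tensor.rep_eq blinfun.scaleR_left matrix_vector_mult_scaleR)
qed

lemma bounded_bilinear_integrand: "bounded_bilinear (\<lambda>x y. S_form Q x o\<^sub>L I_tensor y)"
  using bounded_bilinear.comp[OF bounded_bilinear_blinfun_compose bounded_linear_S_form bounded_linear_I_tensor] .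

lemma integrand_continuous:
  assumes "X \<in> rough_paths p T"
  shows "continuous_on {0..T} (\<lambda>s. S_form Q (path_from x0 X s) o\<^sub>L I_tensor (path_from x0 X s))"
  by (rule bounded_bilinear.continuous_on[OF bounded_bilinear_integrand])
    (rule path_from_continuous[OF assms])+

text \<open>The integrand is a bounded bilinear map on the diagonal, so its change is bounded by that of the path
times a bound for both paths, uniformly on \<open>[0, T]\<close>.\<close>

lemma L_op_dp_continuous:
  assumes X: "X \<in> rough_paths p T" and T: "0 < T" and p: "0 < p" and \<eta>: "0 < \<eta>"
  shows "\<exists>\<delta>>0. \<forall>Y \<in> rough_paths p T. dp p T X Y < ennreal \<delta> \<longrightarrow>
    norm (L_op Q x0 T Y - L_op Q x0 T X) < \<eta>"
proof -
  let ?b = "\<lambda>x y. S_form Q x o\<^sub>L I_tensor y"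
  interpret b: bounded_bilinear ?b by (rule bounded_bilinear_integrand)
  obtain K where K: "0 < K" "\<And>x y. norm (?b x y) \<le> norm x * norm y * K"
    using b.pos_bounded by blast
  have "compact (path_from x0 X ` {0..T})"
    by (rule compact_continuous_image[OF path_from_continuous[OF X]]) simp
  then obtain R where R: "0 < R" "\<And>s. s \<in> {0..T} \<Longrightarrow> norm (path_from x0 X s) \<le> R"
    using compact_imp_bounded bounded_pos by (metis imageI)
  \<comment> \<open>Once the paths differ by less than 1, one is bounded by \<open>R\<close> and the other by \<open>R + 1\<close>.\<close>
  define C where "C = (2 * R + 1) * K * T"
  have C: "0 < C" using R K T by (simp add: C_def)
  define \<delta> where "\<delta> = min 1 (\<eta> / (2 * C))"
  have \<delta>: "0 < \<delta>" "\<delta> \<le> 1" "C * \<delta> \<le> \<eta> / 2"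
    using C \<eta> by (auto simp: \<delta>_def min_def field_simps)
  have "norm (L_op Q x0 T Y - L_op Q x0 T X) < \<eta>"
    if Y: "Y \<in> rough_paths p T" and d: "dp p T X Y < ennreal \<delta>" for Y
  proof -
    let ?x = "path_from x0 X" and ?y = "path_from x0 Y"
    note cont = integrand_continuous[OF X, of Q x0] integrand_continuous[OF Y, of Q x0]
    have "L_op Q x0 T Y - L_op Q x0 T X = integral {0..T} (\<lambda>s. ?b (?y s) (?y s) - ?b (?x s) (?x s))"
      unfolding L_op_def using cont
      by (intro integral_diff[symmetric] integrable_continuous_real)
    also have "norm \<dots> \<le> (\<delta> * (2 * R + 1) * K) * (T - 0)"
    proof (rule integral_bound)
      fix s assume s: "s \<in> {0..T}"
      have close: "norm (?y s - ?x s) \<le> \<delta>"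
        using path_from_close[OF d s p \<delta>(1)] by (rule less_imp_le)
      have "norm (?y s) \<le> norm (?x s) + norm (?y s - ?x s)"
        by (metis add_diff_cancel_left' add.commute diff_add_cancel norm_triangle_ineq)
      then have y: "norm (?y s) \<le> R + 1" using R(2)[OF s] close \<delta>(2) by simp
      have "?b (?y s) (?y s) - ?b (?x s) (?x s) = ?b (?y s - ?x s) (?y s) + ?b (?x s) (?y s - ?x s)"
        by (simp add: b.diff_left b.diff_right)
      also have "norm \<dots> \<le> norm (?y s - ?x s) * norm (?y s) * K + norm (?x s) * norm (?y s - ?x s) * K"
        by (intro norm_triangle_mono K(2))
      also have "\<dots> \<le> \<delta> * (R + 1) * K + R * \<delta> * K"
        using close y R(1) R(2)[OF s] K(1) \<delta>(1) by (intro add_mono mult_mono) auto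
      finally show "norm (?b (?y s) (?y s) - ?b (?x s) (?x s)) \<le> \<delta> * (2 * R + 1) * K"
        by (simp add: algebra_simps)
    qed (use T cont in \<open>auto intro!: continuous_intros\<close>)
    also have "\<dots> = C * \<delta>" by (simp add: C_def)
    also have "\<dots> < \<eta>" using \<delta>(3) \<eta> by simp
    finally show ?thesis .
  qed
  with \<delta>(1) show ?thesis by blast
qed

lemma S_vec_dp_continuous:
  fixes X :: "'d::finite two_level"
  assumes X: "X \<in> rough_paths p T" and T: "0 < T" and p: "0 < p" and \<eta>: "0 < \<eta>"
  shows "\<exists>\<delta>>0. \<forall>Y \<in> rough_paths p T. dp p T X Y < ennreal \<delta> \<longrightarrow>
    norm (S_vec Q x0 T Y - S_vec Q x0 T X) < \<eta>"
proof -
  define D where "D = DF_contract (S_form Q) 0 \<circ> (\<lambda>z. tensor x0 (fst z) + snd z)"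
  have "linear (\<lambda>z :: (real^'d) \<times> (real^'d^'d). tensor x0 (fst z) + snd z)"
    by (rule linearI) (simp_all add: tensor_def vec_eq_iff algebra_simps)
  then have "linear D"
    unfolding D_def by (rule linear_compose) (rule linear_DF_contract)
  then interpret D: bounded_linear D
    by (rule linear_conv_bounded_linear[THEN iffD1])
  obtain K where K: "0 < K" "\<And>z. norm (D z) \<le> norm z * K"
    using D.pos_bounded by blast
  have eq: "S_vec Q x0 T Y = D (Y 0 T)" if "Y \<in> rough_paths p T" for Y
    unfolding S_vec_def D_def
    by (simp add: rough_integral_bounded_linear(2)[OF that T bounded_linear_S_form])
  define \<delta> where "\<delta> = \<eta> / (2 * K)"
  have \<delta>: "0 < \<delta>" using \<eta> K by (simp add: \<delta>_def)
  have "norm (S_vec Q x0 T Y - S_vec Q x0 T X) < \<eta>"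
    if Y: "Y \<in> rough_paths p T" and d: "dp p T X Y < ennreal \<delta>" for Y
  proof -
    have "norm (S_vec Q x0 T Y - S_vec Q x0 T X) \<le> norm (Y 0 T - X 0 T) * K"
      unfolding eq[OF X] eq[OF Y] D.diff[symmetric] by (rule K(2))
    also have "norm (Y 0 T - X 0 T) \<le> norm (fst (Y 0 T - X 0 T)) + norm (snd (Y 0 T - X 0 T))"
      by (metis norm_Pair_le prod.collapse)
    also have "\<dots> < \<delta> + \<delta>"
      using dp_less_imp_increments_close[OF d T order_refl p]
      by (intro add_strict_mono) (auto simp: norm_minus_commute)
    finally show ?thesis using K(1) by (simp add: \<delta>_def field_simps)
  qed
  with \<delta> show ?thesis by blast
qed

lemma blinfun_bounded_below:
  fixes L :: "'v::euclidean_space \<Rightarrow>\<^sub>L 'w::real_normed_vector"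
  assumes "inj (blinfun_apply L)"
  shows "\<exists>c>0. \<forall>v. c * norm v \<le> norm (blinfun_apply L v)"
proof -
  have "continuous_on (sphere 0 1) (\<lambda>v. norm (blinfun_apply L v))"
    by (intro continuous_intros)
  then obtain v0 where v0: "v0 \<in> sphere 0 1"
    "\<And>v. v \<in> sphere 0 1 \<Longrightarrow> norm (blinfun_apply L v0) \<le> norm (blinfun_apply L v)"
    using continuous_attains_inf[of "sphere 0 (1::real) :: 'v set"] by fastforce
  have "blinfun_apply L v0 \<noteq> blinfun_apply L 0"
    using assms v0(1) by (metis injD dist_self mem_sphere zero_neq_one)
  then have pos: "0 < norm (blinfun_apply L v0)" by (simp add: blinfun.zero_right)
  have "norm (blinfun_apply L v0) * norm v \<le> norm (blinfun_apply L v)" for v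
  proof (cases "v = 0")
    case False
    then have "norm (blinfun_apply L v0) \<le> norm (blinfun_apply L ((1 / norm v) *\<^sub>R v))"
      by (intro v0(2)) simp
    then show ?thesis using False by (simp add: blinfun.scaleR_right field_simps)
  qed (simp add: blinfun.zero_right)
  with pos show ?thesis by blast
qed

text \<open>An injective \<open>L\<close> on a finite-dimensional space is bounded below by some \<open>c > 0\<close>, and operators within
\<open>c / 2\<close> of it by \<open>c / 2\<close>, hence they are injective too. They are onto because \<open>L\<^sup>-\<^sup>1 L'\<close> is an injective
endomorphism of a finite-dimensional space. The distance of the solutions \<open>G = L\<^sup>-\<^sup>1 S\<close> and \<open>G'\<close> is then read
off from \<open>L' (G' - G) = (S' - S) - (L' - L) G\<close>.\<close>

lemma blinfun_solution_stable:
  fixes L :: "'v::euclidean_space \<Rightarrow>\<^sub>L 'w::real_normed_vector"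
  assumes L: "bij (blinfun_apply L)" and \<epsilon>: "0 < \<epsilon>"
  shows "\<exists>\<eta>>0. \<forall>L' S'. norm (L' - L) < \<eta> \<and> norm (S' - S) < \<eta> \<longrightarrow>
    bij (blinfun_apply L') \<and> dist (inv (blinfun_apply L) S) (inv (blinfun_apply L') S') < \<epsilon>"
proof -
  obtain c where c: "0 < c" "\<And>v. c * norm v \<le> norm (blinfun_apply L v)"
    using blinfun_bounded_below[of L] L by (auto simp: bij_def)
  define G where "G = inv (blinfun_apply L) S"
  have LG: "blinfun_apply L G = S" using L by (simp add: G_def bij_def surj_f_inv_f)
  define \<eta> where "\<eta> = min (c / 2) (\<epsilon> * c / (4 * (1 + norm G)))"
  have G1: "0 < 1 + norm G" by (simp add: add_pos_nonneg)
  have \<eta>: "0 < \<eta>" "\<eta> \<le> c / 2" "\<eta> * (1 + norm G) \<le> \<epsilon> * c / 4"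
  proof -
    show "0 < \<eta>" using c \<epsilon> G1 by (auto simp: \<eta>_def)
    show "\<eta> \<le> c / 2" unfolding \<eta>_def by (rule min.cobounded1)
    have "\<eta> * (1 + norm G) \<le> \<epsilon> * c / (4 * (1 + norm G)) * (1 + norm G)"
      using G1 by (intro mult_right_mono) (auto simp: \<eta>_def)
    also have "\<dots> = \<epsilon> * c / 4"
      using less_imp_neq[OF G1] nonzero_mult_divide_mult_cancel_right[of "1 + norm G" "\<epsilon> * c" 4]
      unfolding times_divide_eq_left by metis
    finally show "\<eta> * (1 + norm G) \<le> \<epsilon> * c / 4" .
  qed
  have "bij (blinfun_apply L') \<and> dist G (inv (blinfun_apply L') S') < \<epsilon>"
    if L': "norm (L' - L) < \<eta>" and S': "norm (S' - S) < \<eta>" for L' S'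
  proof -
    have diff: "norm (blinfun_apply L' v - blinfun_apply L v) \<le> \<eta> * norm v" for v
    proof -
      have "norm (blinfun_apply (L' - L) v) \<le> norm (L' - L) * norm v" by (rule norm_blinfun)
      also have "\<dots> \<le> \<eta> * norm v" using L' by (intro mult_right_mono) auto
      finally show ?thesis by (simp add: blinfun.diff_left)
    qed
    have below: "c / 2 * norm v \<le> norm (blinfun_apply L' v)" for v
    proof -
      have "norm (blinfun_apply L v) \<le> norm (blinfun_apply L' v) + norm (blinfun_apply L' v - blinfun_apply L v)"
        using norm_triangle_sub norm_minus_commute by metis
      moreover have "\<eta> * norm v \<le> c / 2 * norm v" using \<eta>(2) by (rule mult_right_mono) simp
      ultimately show ?thesis using c(2)[of v] diff[of v] by simp
    qed
    have inj': "inj (blinfun_apply L')"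
    proof (rule injI)
      fix u v assume "blinfun_apply L' u = blinfun_apply L' v"
      then have "c / 2 * norm (u - v) \<le> 0" using below[of "u - v"] by (simp add: blinfun.diff_right)
      then show "u = v" using c(1) by (simp add: mult_le_0_iff)
    qed
    define h where "h = inv (blinfun_apply L) \<circ> blinfun_apply L'"
    have linv: "linear (inv (blinfun_apply L))"
    proof (rule linearI)
      fix x y :: 'w and r :: real
      have *: "blinfun_apply L (inv (blinfun_apply L) z) = z" for z
        using L by (simp add: bij_def surj_f_inv_f)
      have **: "inv (blinfun_apply L) (blinfun_apply L v) = v" for v
        using L by (simp add: bij_def)
      show "inv (blinfun_apply L) (x + y) = inv (blinfun_apply L) x + inv (blinfun_apply L) y"
        using **[of "inv (blinfun_apply L) x + inv (blinfun_apply L) y"] by (simp add: blinfun.add_right *)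
      show "inv (blinfun_apply L) (r *\<^sub>R x) = r *\<^sub>R inv (blinfun_apply L) x"
        using **[of "r *\<^sub>R inv (blinfun_apply L) x"] by (simp add: blinfun.scaleR_right *)
    qed
    have "linear h"
      unfolding h_def
      by (intro linear_compose linv bounded_linear.linear[OF blinfun.bounded_linear_right])
    moreover have "inj h"
      unfolding h_def by (rule inj_compose[OF bij_is_inj[OF bij_imp_bij_inv[OF L]] inj'])
    ultimately have "surj h"
      using linear_injective_imp_surjective by blast
    have "surj (blinfun_apply L')"
    proof -
      have "blinfun_apply L' = blinfun_apply L \<circ> h"
        using L by (auto simp: h_def fun_eq_iff bij_def surj_f_inv_f)
      then show ?thesis using \<open>surj h\<close> L by (metis bij_is_surj comp_surj)
    qed
    with inj' have bij': "bij (blinfun_apply L')" by (simp add: bij_def)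
    define G' where "G' = inv (blinfun_apply L') S'"
    have LG': "blinfun_apply L' G' = S'" using bij' by (simp add: G'_def bij_def surj_f_inv_f)
    have "blinfun_apply L' (G' - G) = (S' - S) - (blinfun_apply L' G - blinfun_apply L G)"
      by (simp add: blinfun.diff_right LG LG')
    then have "norm (blinfun_apply L' (G' - G)) \<le> norm (S' - S) + norm (blinfun_apply L' G - blinfun_apply L G)"
      by (simp add: norm_triangle_ineq4)
    also have "\<dots> \<le> \<eta> * (1 + norm G)"
      using S' diff[of G] by (simp add: algebra_simps)
    finally have "c / 2 * norm (G' - G) \<le> \<epsilon> * c / 4"
      using below[of "G' - G"] \<eta>(3) by linarith
    then have "norm (G' - G) \<le> \<epsilon> / 2" using c(1) by (simp add: field_simps)
    then show ?thesis using bij' \<epsilon> by (simp add: G'_def[symmetric] dist_norm norm_minus_commute)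
  qed
  with \<eta>(1) show ?thesis unfolding G_def by blast
qed

lemma drift_estimator_continuous:
  assumes X: "X \<in> estimator_domain p \<Sigma> x0 T" and T: "0 < T" and p: "0 < p" and \<epsilon>: "0 < \<epsilon>"
  shows "\<exists>\<delta>>0. \<forall>Y \<in> rough_paths p T. dp p T X Y < ennreal \<delta> \<longrightarrow>
    Y \<in> estimator_domain p \<Sigma> x0 T \<and> dist (drift_estimator \<Sigma> x0 T X) (drift_estimator \<Sigma> x0 T Y) < \<epsilon>"
proof -
  let ?Q = "\<Sigma> ** transpose \<Sigma>"
  have rX: "X \<in> rough_paths p T" and bX: "bij (blinfun_apply (L_op ?Q x0 T X))"
    using X by (auto simp: estimator_domain_def)
  obtain \<eta> where \<eta>: "0 < \<eta>" and stable: "\<And>L' S'. norm (L' - L_op ?Q x0 T X) < \<eta> \<Longrightarrow>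
      norm (S' - S_vec ?Q x0 T X) < \<eta> \<Longrightarrow> bij (blinfun_apply L') \<and>
      dist (inv (blinfun_apply (L_op ?Q x0 T X)) (S_vec ?Q x0 T X)) (inv (blinfun_apply L') S') < \<epsilon>"
    using blinfun_solution_stable[OF bX \<epsilon>, of "S_vec ?Q x0 T X"] by blast
  obtain \<delta>1 where \<delta>1: "0 < \<delta>1" "\<And>Y. Y \<in> rough_paths p T \<Longrightarrow> dp p T X Y < ennreal \<delta>1 \<Longrightarrow>
      norm (L_op ?Q x0 T Y - L_op ?Q x0 T X) < \<eta>"
    using L_op_dp_continuous[OF rX T p \<eta>] by blast
  obtain \<delta>2 where \<delta>2: "0 < \<delta>2" "\<And>Y. Y \<in> rough_paths p T \<Longrightarrow> dp p T X Y < ennreal \<delta>2 \<Longrightarrow>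
      norm (S_vec ?Q x0 T Y - S_vec ?Q x0 T X) < \<eta>"
    using S_vec_dp_continuous[OF rX T p \<eta>] by blast
  have "Y \<in> estimator_domain p \<Sigma> x0 T \<and> dist (drift_estimator \<Sigma> x0 T X) (drift_estimator \<Sigma> x0 T Y) < \<epsilon>"
    if Y: "Y \<in> rough_paths p T" and d: "dp p T X Y < ennreal (min \<delta>1 \<delta>2)" for Y
  proof -
    have "dp p T X Y < ennreal \<delta>1" "dp p T X Y < ennreal \<delta>2"
      using d by (auto elim!: order.strict_trans2 intro: ennreal_leI)
    then show ?thesis
      using stable[OF \<delta>1(2)[OF Y] \<delta>2(2)[OF Y]] Y
      by (simp add: estimator_domain_def drift_estimator_def dist_minus)
  qed
  with \<delta>1(1) \<delta>2(1) show ?thesis by (intro exI[of _ "min \<delta>1 \<delta>2"]) auto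
qed

section \<open>Almost every enhanced path lies in the domain\<close>

lemma norm_reindex_le:
  fixes x :: "real^'n" and f :: "'m::finite \<Rightarrow> 'n"
  assumes "inj f"
  shows "norm (\<chi> i. x $ f i) \<le> norm x"
proof -
  have "(\<Sum>i\<in>UNIV. (x $ f i)\<^sup>2) = (\<Sum>k\<in>range f. (x $ k)\<^sup>2)"
    using assms by (simp add: sum.reindex)
  also have "\<dots> \<le> (\<Sum>k\<in>UNIV. (x $ k)\<^sup>2)"
    by (rule sum_mono2) auto
  finally show ?thesis by (simp add: norm_vec_def L2_set_def)
qed

lemma norm_block_le:
  fixes A :: "real^'n^'n" and f :: "'m::finite \<Rightarrow> 'n"
  assumes "inj f"
  shows "norm (\<chi> i j. A $ f i $ f j) \<le> norm A"
proof -
  have "norm (\<chi> i j. A $ f i $ f j) \<le> norm (\<chi> k j. A $ k $ f j)"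
  proof -
    have "(\<Sum>i\<in>UNIV. (norm (\<chi> j. A $ f i $ f j))\<^sup>2) = (\<Sum>k\<in>range f. (norm (\<chi> j. A $ k $ f j))\<^sup>2)"
      using assms by (simp add: sum.reindex)
    also have "\<dots> \<le> (\<Sum>k\<in>UNIV. (norm (\<chi> j. A $ k $ f j))\<^sup>2)"
      by (rule sum_mono2) auto
    finally show ?thesis
      unfolding norm_vec_def[of "\<chi> i j. A $ f i $ f j"] norm_vec_def[of "\<chi> k j. A $ k $ f j"]
      by (simp add: L2_set_def)
  qed
  also have "\<dots> \<le> norm A"
    by (rule norm_le_componentwise_cart) (simp add: norm_reindex_le[OF assms])
  finally show ?thesis .
qed

text \<open>Selecting coordinates does not increase norms, so the control of the large rough path serves the block.\<close>

lemma rough_path_block: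
  fixes f :: "'m::finite \<Rightarrow> 'n::finite"
  assumes f: "inj f" and Z: "Z \<in> rough_paths p T"
    and Y: "\<And>s t. 0 \<le> s \<Longrightarrow> s < t \<Longrightarrow> t \<le> T \<Longrightarrow>
      Y s t = ((\<chi> i. fst (Z s t) $ f i), (\<chi> i j. snd (Z s t) $ f i $ f j))"
  shows "Y \<in> rough_paths p T"
proof -
  obtain z where z: "continuous_on {0..T} z"
      "\<And>s t. 0 \<le> s \<and> s < t \<and> t \<le> T \<Longrightarrow> fst (Z s t) = z t - z s"
    and chen: "\<And>s u t. 0 \<le> s \<and> s < u \<and> u < t \<and> t \<le> T \<Longrightarrow>
      snd (Z s t) - snd (Z s u) - snd (Z u t) = tensor (fst (Z s u)) (fst (Z u t))"
    using Z unfolding rough_paths_def by blast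
  obtain \<omega> where \<omega>: "control T \<omega>" "\<And>s t. 0 \<le> s \<and> s < t \<and> t \<le> T \<Longrightarrow>
      norm (fst (Z s t)) \<le> \<omega> s t powr (1 / p) \<and> norm (snd (Z s t)) \<le> \<omega> s t powr (2 / p)"
    using Z unfolding rough_paths_def by blast
  have "continuous_on {0..T} (\<lambda>t. \<chi> i. z t $ f i)"
    using z(1) by (intro continuous_intros)
  moreover have "\<forall>s t. 0 \<le> s \<and> s < t \<and> t \<le> T \<longrightarrow> fst (Y s t) = (\<chi> i. z t $ f i) - (\<chi> i. z s $ f i)"
    using Y z(2) by (simp add: vec_eq_iff)
  moreover have "snd (Y s t) - snd (Y s u) - snd (Y u t) = tensor (fst (Y s u)) (fst (Y u t))"
    if st: "0 \<le> s \<and> s < u \<and> u < t \<and> t \<le> T" for s u t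
  proof -
    have "snd (Z s t) $ f i $ f j - snd (Z s u) $ f i $ f j - snd (Z u t) $ f i $ f j
        = fst (Z s u) $ f i * fst (Z u t) $ f j" for i j
      using arg_cong[OF chen[OF st], of "\<lambda>A. A $ f i $ f j"] by (simp add: tensor_def)
    then show ?thesis using st by (simp add: Y tensor_def vec_eq_iff)
  qed
  moreover have "norm (fst (Y s t)) \<le> \<omega> s t powr (1 / p) \<and> norm (snd (Y s t)) \<le> \<omega> s t powr (2 / p)"
    if st: "0 \<le> s \<and> s < t \<and> t \<le> T" for s t
    using st \<omega>(2)[OF st] norm_reindex_le[OF f, of "fst (Z s t)"] norm_block_le[OF f, of "snd (Z s t)"]
    by (simp add: Y)
  ultimately show ?thesis
    unfolding rough_paths_def using \<omega>(1) by blast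
qed

text \<open>With \<open>a = Q b\<close> the form equals \<open>\<bar>\<Sigma>\<^sup>T b\<bar>\<^sup>2\<close>.\<close>

lemma inner_matrix_inv_gram:
  fixes \<Sigma> :: "real^'d^'d"
  assumes \<Sigma>: "invertible \<Sigma>"
  defines "Q \<equiv> \<Sigma> ** transpose \<Sigma>"
  shows "0 \<le> a \<bullet> (matrix_inv Q *v a)"
    and "a \<bullet> (matrix_inv Q *v a) = 0 \<longleftrightarrow> a = 0"
proof -
  define b where "b = matrix_inv Q *v a"
  have "invertible Q"
    using \<Sigma> unfolding Q_def by (intro invertible_mult transpose_invertible)
  then have "Q ** matrix_inv Q = mat 1"
    unfolding matrix_inv_def invertible_def by (rule someI_ex[THEN conjunct1])
  then have a: "a = Q *v b"
    by (simp add: b_def matrix_vector_mul_assoc)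
  have eq: "a \<bullet> (matrix_inv Q *v a) = (transpose \<Sigma> *v b) \<bullet> (transpose \<Sigma> *v b)"
  proof -
    have "a \<bullet> b = b \<bullet> (\<Sigma> *v (transpose \<Sigma> *v b))"
      by (simp add: a Q_def matrix_vector_mul_assoc inner_commute del: transpose_matrix_vector)
    also have "\<dots> = (transpose \<Sigma> *v b) \<bullet> (transpose \<Sigma> *v b)"
      by (subst dot_lmul_matrix[symmetric]) (simp add: transpose_matrix_vector)
    finally show ?thesis by (simp add: b_def)
  qed
  show "0 \<le> a \<bullet> (matrix_inv Q *v a)" unfolding eq by simp
  have "transpose \<Sigma> *v b = 0 \<Longrightarrow> a = 0"
    unfolding a Q_def by (simp add: matrix_vector_mul_assoc[symmetric])
  then show "a \<bullet> (matrix_inv Q *v a) = 0 \<longleftrightarrow> a = 0"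
    using eq by auto
qed

lemma L_op_apply:
  assumes X: "X \<in> rough_paths p T"
  shows "blinfun_apply (blinfun_apply (L_op Q x0 T X) G) K =
    integral {0..T} (\<lambda>s. (K *v path_from x0 X s) \<bullet> (matrix_inv Q *v (G *v path_from x0 X s)))"
proof -
  let ?f = "\<lambda>s. S_form Q (path_from x0 X s) o\<^sub>L I_tensor (path_from x0 X s)"
  have lin: "bounded_linear (\<lambda>A. blinfun_apply (blinfun_apply A G) K)"
    by (intro bounded_linear_compose[OF blinfun.bounded_linear_left] blinfun.bounded_linear_left)
  have "?f integrable_on {0..T}"
    using integrand_continuous[OF X] by (rule integrable_continuous_real)
  from integral_linear[OF this lin] show ?thesis
    by (simp add: L_op_def o_def S_form_apply I_tensor.rep_eq)
qed

text \<open>The Riesz map \<open>R\<close> identifies the dual with the space itself, where injective endomorphisms are onto.\<close>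

lemma inj_blinfun_to_dual_imp_bij:
  fixes L :: "'v::euclidean_space \<Rightarrow>\<^sub>L ('v \<Rightarrow>\<^sub>L real)"
  assumes "inj (blinfun_apply L)"
  shows "bij (blinfun_apply L)"
proof -
  define R :: "('v \<Rightarrow>\<^sub>L real) \<Rightarrow> 'v" where "R f = (\<Sum>b\<in>Basis. blinfun_apply f b *\<^sub>R b)" for f
  have R_inner: "R f \<bullet> b = blinfun_apply f b" if "b \<in> Basis" for f b
    using that by (simp add: R_def)
  have "inj R"
    by (rule injI, rule blinfun_euclidean_eqI) (metis R_inner)
  have "linear R"
    by (rule linearI) (simp_all add: R_def blinfun.add_left blinfun.scaleR_left
      scaleR_add_left sum.distrib scaleR_sum_right)
  then have "linear (R \<circ> blinfun_apply L)"
    by (intro linear_compose bounded_linear.linear[OF blinfun.bounded_linear_right])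
  moreover have "inj (R \<circ> blinfun_apply L)"
    by (rule inj_compose[OF \<open>inj R\<close> assms])
  ultimately have "surj (R \<circ> blinfun_apply L)"
    using linear_injective_imp_surjective by blast
  have "surj (blinfun_apply L)"
    unfolding surj_def
  proof
    fix f
    obtain v where "R f = (R \<circ> blinfun_apply L) v"
      using \<open>surj (R \<circ> blinfun_apply L)\<close> by (rule surjE)
    then show "\<exists>v. f = blinfun_apply L v" using \<open>inj R\<close> by (metis comp_apply injD)
  qed
  with assms show ?thesis by (simp add: bij_def)
qed

text \<open>If \<open>L G = 0\<close>, evaluating at \<open>G\<close> gives a vanishing integral of a continuous nonnegative function, so
\<open>G X\<^sub>s = 0\<close> for all \<open>s\<close>; then every row of \<open>G\<close> is orthogonal to the path.\<close>

lemma L_op_bij: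
  fixes \<Sigma> :: "real^'d^'d"
  assumes X: "X \<in> rough_paths p T" and T: "0 < T" and \<Sigma>: "invertible \<Sigma>"
    and span: "\<And>v. (\<And>s. s \<in> {0..T} \<Longrightarrow> v \<bullet> path_from x0 X s = 0) \<Longrightarrow> v = 0"
  shows "bij (blinfun_apply (L_op (\<Sigma> ** transpose \<Sigma>) x0 T X))"
proof (rule inj_blinfun_to_dual_imp_bij)
  let ?Q = "\<Sigma> ** transpose \<Sigma>" and ?x = "path_from x0 X"
  let ?L = "L_op ?Q x0 T X"
  have cont: "continuous_on {0..T} ?x" by (rule path_from_continuous[OF X])
  have "G = 0" if G: "blinfun_apply ?L G = 0" for G
  proof -
    let ?g = "\<lambda>s. (G *v ?x s) \<bullet> (matrix_inv ?Q *v (G *v ?x s))"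
    have "integral {0..T} ?g = 0"
      using L_op_apply[OF X, of ?Q x0 G G] G by (simp add: blinfun.zero_left)
    moreover have "continuous_on {0..T} ?g"
      by (intro continuous_intros matrix_vector_mult_linear_continuous_on[THEN continuous_on_compose2] cont) auto
    ultimately have "\<forall>s\<in>{0..T}. ?g s = 0"
      using integral_eq_0_iff[of 0 T ?g] T inner_matrix_inv_gram(1)[OF \<Sigma>] by simp
    then have "G *v ?x s = 0" if "s \<in> {0..T}" for s
      using that inner_matrix_inv_gram(2)[OF \<Sigma>] by simp
    then have "row i G \<bullet> ?x s = 0" if "s \<in> {0..T}" for i s
      using that by (metis matrix_vector_mul_component row_def vec_lambda_eta zero_index)
    then have "row i G = 0" for i
      by (rule span)
    then show "G = 0" by (simp add: row_def vec_eq_iff)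
  qed
  then show "inj (blinfun_apply ?L)"
    by (subst linear_injective_0[OF bounded_linear.linear[OF blinfun.bounded_linear_right]]) blast
qed

text \<open>Pairing the equation with \<open>v\<close> removes \<open>X\<close> itself, and what remains of \<open>v \<bullet> \<Sigma> B\<close> is the drift
integral, which is Lipschitz.\<close>

lemma orthogonal_fOU_imp_lipschitz_projection:
  fixes \<Gamma> \<Sigma> :: "real^'d^'d"
  assumes x: "continuous_on {0..T} x"
    and eq: "\<And>t. t \<in> {0..T} \<Longrightarrow> x t - x 0 = - integral {0..t} (\<lambda>s. \<Gamma> *v x s) + \<Sigma> *v (b t - b 0)"
    and orth: "\<And>s. s \<in> {0..T} \<Longrightarrow> v \<bullet> x s = 0"
  shows "\<exists>C. \<forall>s t. 0 \<le> s \<and> s \<le> t \<and> t \<le> T \<longrightarrow> \<bar>(transpose \<Sigma> *v v) \<bullet> (b t - b s)\<bar> \<le> C * (t - s)"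
proof -
  have cont: "continuous_on {0..T} (\<lambda>s. \<Gamma> *v x s)"
    by (intro matrix_vector_mult_linear_continuous_on[THEN continuous_on_compose2] x) auto
  then have "compact ((\<lambda>s. \<Gamma> *v x s) ` {0..T})"
    by (rule compact_continuous_image) simp
  then obtain R where R: "\<And>s. s \<in> {0..T} \<Longrightarrow> norm (\<Gamma> *v x s) \<le> R"
    using compact_imp_bounded bounded_iff by (metis imageI)
  have "\<bar>(transpose \<Sigma> *v v) \<bullet> (b t - b s)\<bar> \<le> norm v * R * (t - s)"
    if st: "0 \<le> s \<and> s \<le> t \<and> t \<le> T" for s t
  proof -
    have cont_t: "continuous_on {0..t} (\<lambda>s. \<Gamma> *v x s)" "continuous_on {s..t} (\<lambda>s. \<Gamma> *v x s)"
      using st by (auto intro: continuous_on_subset[OF cont])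
    have split: "integral {0..t} (\<lambda>s. \<Gamma> *v x s) =
        integral {0..s} (\<lambda>s. \<Gamma> *v x s) + integral {s..t} (\<lambda>s. \<Gamma> *v x s)"
      using st cont_t by (intro Henstock_Kurzweil_Integration.integral_combine[symmetric] integrable_continuous_real) auto
    have b: "\<Sigma> *v (b u - b 0) = x u - x 0 + integral {0..u} (\<lambda>s. \<Gamma> *v x s)" if "u \<in> {0..T}" for u
      by (subst eq[OF that]) simp
    have "\<Sigma> *v (b t - b s) = \<Sigma> *v (b t - b 0) - \<Sigma> *v (b s - b 0)"
      by (simp add: matrix_vector_mult_diff_distrib)
    also have "\<dots> = x t - x s + integral {s..t} (\<lambda>s. \<Gamma> *v x s)"
      using st by (simp add: b split)
    finally have "v \<bullet> (\<Sigma> *v (b t - b s)) = v \<bullet> integral {s..t} (\<lambda>s. \<Gamma> *v x s)"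
      using orth[of t] orth[of s] st by (simp add: inner_simps)
    then have "(transpose \<Sigma> *v v) \<bullet> (b t - b s) = v \<bullet> integral {s..t} (\<lambda>s. \<Gamma> *v x s)"
      by (simp add: dot_lmul_matrix)
    also have "\<bar>\<dots>\<bar> \<le> norm v * norm (integral {s..t} (\<lambda>s. \<Gamma> *v x s))"
      by (rule Cauchy_Schwarz_ineq2)
    also have "\<dots> \<le> norm v * (R * (t - s))"
      using st R cont_t by (intro mult_left_mono integral_bound) auto
    finally show ?thesis by (simp add: ac_simps)
  qed
  then show ?thesis by blast
qed

theorem theorem4p9:
  fixes M :: "'a measure"
    and H p T :: real
    and \<Gamma> \<Sigma> :: "real^'d^'d"
    and x0 :: "real^'d"
    and B X :: "real \<Rightarrow> 'a \<Rightarrow> real^'d"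
    and BB XX :: "'a \<Rightarrow> 'd two_level"
  assumes T: "0 < T"
    and H: "1 / 3 < H" "H \<le> 1 / 2"
    and p: "1 / H < p" "p < 3"
    and \<Gamma>_sym: "transpose \<Gamma> = \<Gamma>"
    and \<Gamma>_pos: "\<And>v. v \<noteq> 0 \<Longrightarrow> 0 < v \<bullet> (\<Gamma> *v v)"
    and \<Sigma>: "invertible \<Sigma>"
    and B: "fBm M H T B"
    and BB: "canonical_lift M p T B BB"
    and X: "fOU M T \<Gamma> \<Sigma> x0 B X"
    and XX: "ito_enhancement M p T H \<Gamma> \<Sigma> B BB X XX"
  shows "(AE \<omega> in M. XX \<omega> \<in> estimator_domain p \<Sigma> x0 T) \<and>
         (\<forall>\<X> \<in> estimator_domain p \<Sigma> x0 T. \<forall>\<epsilon>>0. \<exists>\<delta>>0. \<forall>\<Y> \<in> rough_paths p T.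
            dp p T \<X> \<Y> < ennreal \<delta> \<longrightarrow>
              \<Y> \<in> estimator_domain p \<Sigma> x0 T \<and>
              dist (drift_estimator \<Sigma> x0 T \<X>) (drift_estimator \<Sigma> x0 T \<Y>) < \<epsilon>)"
proof
  have H0: "0 < H" using H by simp
  have p0: "0 < p" using p(1) H0 by (meson less_trans zero_less_divide_1_iff)
  show "\<forall>\<X> \<in> estimator_domain p \<Sigma> x0 T. \<forall>\<epsilon>>0. \<exists>\<delta>>0. \<forall>\<Y> \<in> rough_paths p T.
      dp p T \<X> \<Y> < ennreal \<delta> \<longrightarrow> \<Y> \<in> estimator_domain p \<Sigma> x0 T \<and>
        dist (drift_estimator \<Sigma> x0 T \<X>) (drift_estimator \<Sigma> x0 T \<Y>) < \<epsilon>"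
    using drift_estimator_continuous[OF _ T p0] by blast
  have rough: "AE \<omega> in M. XX \<omega> \<in> rough_paths p T \<and>
      (\<forall>s t. 0 \<le> s \<and> s < t \<and> t \<le> T \<longrightarrow> fst (XX \<omega> s t) = X t \<omega> - X s \<omega>)"
    using XX[unfolded ito_enhancement_def]
  proof eventually_elim
    case (elim \<omega>)
    then obtain Z where Z: "ito_rde_solution p T H \<Gamma> \<Sigma> (\<lambda>t. B t \<omega>) (BB \<omega>) (\<lambda>t. X t \<omega>) Z"
      and block: "\<And>s t. 0 \<le> s \<and> s < t \<and> t \<le> T \<Longrightarrow>
        XX \<omega> s t = (snd_part (fst (Z s t)), \<chi> i j. snd (Z s t) $ Inr (Inl i) $ Inr (Inl j))"
      by blast
    have "inj (\<lambda>i :: 'd. Inr (Inl i) :: 'd + 'd + unit)" by (simp add: inj_def)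
    moreover have "Z \<in> rough_paths p T" using Z by (simp add: ito_rde_solution_def)
    ultimately have "XX \<omega> \<in> rough_paths p T"
      by (rule rough_path_block) (simp add: block snd_part_def)
    moreover have "fst (XX \<omega> s t) = X t \<omega> - X s \<omega>" if st: "0 \<le> s \<and> s < t \<and> t \<le> T" for s t
    proof -
      have "fst (Z s t) = join (B t \<omega>) (X t \<omega>) t - join (B s \<omega>) (X s \<omega>) s"
        using Z st by (simp add: ito_rde_solution_def)
      then show ?thesis by (simp add: block[OF st] snd_part_def join_def vec_eq_iff)
    qed
    ultimately show ?case by blast
  qed
  show "AE \<omega> in M. XX \<omega> \<in> estimator_domain p \<Sigma> x0 T"
    using rough X[unfolded fOU_def] fBm_no_lipschitz_projection[OF B T H0 H(2)]
  proof eventually_elim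
    case (elim \<omega>)
    have path: "path_from x0 (XX \<omega>) s = X s \<omega>" if "s \<in> {0..T}" for s
      using that elim(1,2) by (auto simp: path_from_def lev1_def)
    have "bij (blinfun_apply (L_op (\<Sigma> ** transpose \<Sigma>) x0 T (XX \<omega>)))"
    proof (rule L_op_bij[OF _ T \<Sigma>])
      show "XX \<omega> \<in> rough_paths p T" using elim(1) by blast
      fix v assume "\<And>s. s \<in> {0..T} \<Longrightarrow> v \<bullet> path_from x0 (XX \<omega>) s = 0"
      then have "\<exists>C. \<forall>s t. 0 \<le> s \<and> s \<le> t \<and> t \<le> T \<longrightarrow>
          \<bar>(transpose \<Sigma> *v v) \<bullet> (B t \<omega> - B s \<omega>)\<bar> \<le> C * (t - s)"
        using elim(2) path
        by (intro orthogonal_fOU_imp_lipschitz_projection[where x = "\<lambda>t. X t \<omega>" and \<Gamma> = \<Gamma>]) auto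
      then have "transpose \<Sigma> *v v = 0" using elim(3) by blast
      then show "v = 0"
        using transpose_invertible[OF \<Sigma>] by (metis invertible_def matrix_left_invertible_ker)
    qed
    with elim(1) show ?case by (simp add: estimator_domain_def)
  qed
qed

end
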